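(* Let $N\geq 3$ be odd and let $V$ be an $N$-dimensional real vector space with a Lorentz-signature inner product $\eta_{ab}$. Then there exist bivectors $K_{ab}=-K_{ba}$ on $V$ of real alignment type $0$. Moreover, every bivector $K_{ab}$ on $V$ of real alignment type $0$ has complex alignment type $(1,1)$, and it can be put into the canonical form $$K_{ab}=\lambda_0\left(n_{[a}\,m^{N-1}{}_{b]}+\ell_{[a}\,m^{N-1}{}_{b]}\right)+\sum_{p=1}^{(N-3)/2}\lambda_p\, m^{2p}{}_{[a}\,m^{2p+1}{}_{b]},$$ for some real null frame $\ell,n,m_2,\dots,m_{N-1}$ of $V$ and some real numbers $\lambda_0,\dots,\lambda_{(N-3)/2}$.
   Context: Lorentz signature means signature $(N-1,1)$, with $\eta(u,u)<0$ for time-like and $\eta(u,u)>0$ for space-like $u$. Indices are raised and lowered with $\eta_{ab}$; square brackets denote antisymmetrization. A null frame is a basis $\ell=m_0$, $n=m_1$, $m_2,\dots,m_{N-1}$ with $\eta(\ell,n)=1$, $\eta(m_i,m_i)=1$ for $i=2,\dots,N-1$, and all other products zero; $m^i=m_i$ for space-like indices $i\geq 2$. Real null frames are null frames of $V$; complex null frames are null frames of the complexification $V\otimes\mathbb{C}$ with the complex-bilinear extension of $\eta$. Components with respect to a null frame are $K_{AB}=K(m_A,m_B)$, with $K$ extended complex-bilinearly in the complex case; indices $i,j$ range over $2,\dots,N-1$. For a non-zero bivector, the real (resp. complex) alignment type is defined using real (resp. complex) null frames: type $0$ if, relative to every null frame, $K_{0i}\neq 0$ for some $i$; type $2$ if there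 is a null frame with $K_{0i}=0$, $K_{01}=0$, $K_{ij}=0$ for all $i,j$; type $(1,1)$ if it is not of type $2$ and there is a null frame with $K_{0i}=K_{1i}=0$ for all $i$; type $1$ if there is a null frame with $K_{0i}=0$ for all $i$, but it is of neither type $2$ nor type $(1,1)$. *)

theory Defs
  imports "HOL-Analysis.Analysis"
begin

(* The scalar multiplication is a parameter so that the same notions serve V itself
   (over the reals) and its complexification (over the complex numbers). *)

definition basis_family :: "('f::field \<Rightarrow> 'w::ab_group_add \<Rightarrow> 'w) \<Rightarrow> nat \<Rightarrow> (nat \<Rightarrow> 'w) \<Rightarrow> bool" where
  "basis_family smul N m \<longleftrightarrow>
     inj_on m {..<N} \<and> \<not> module.dependent smul (m ` {..<N}) \<and> module.span smul (m ` {..<N}) = UNIV"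

definition lorentzian :: "nat \<Rightarrow> ('v::real_vector \<Rightarrow> 'v \<Rightarrow> real) \<Rightarrow> bool" where
  "lorentzian N \<eta> \<longleftrightarrow> bilinear \<eta> \<and> (\<forall>x y. \<eta> x y = \<eta> y x) \<and>
     (\<exists>e. basis_family (*\<^sub>R) N e \<and>
        (\<forall>A<N. \<forall>B<N. \<eta> (e A) (e B) = (if A \<noteq> B then 0 else if A = 0 then - 1 else 1)))"

definition bivector :: "('v::real_vector \<Rightarrow> 'v \<Rightarrow> real) \<Rightarrow> bool" where
  "bivector K \<longleftrightarrow> bilinear K \<and> (\<forall>x y. K x y = - K y x)"

(* The complexification of V is the additive group V \<times> V, where (u, w) stands for
   u + i w, with the following scalar multiplication. *)

definition complexify_scale :: "complex \<Rightarrow> 'v::real_vector \<times> 'v \<Rightarrow> 'v \<times> 'v" where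
  "complexify_scale z v =
     (Re z *\<^sub>R fst v - Im z *\<^sub>R snd v, Re z *\<^sub>R snd v + Im z *\<^sub>R fst v)"

global_interpretation complexification: vector_space complexify_scale
  by unfold_locales
    (simp_all add: complexify_scale_def prod_eq_iff scaleR_add_left scaleR_add_right
      scaleR_diff_left scaleR_diff_right algebra_simps)

definition complexify_form ::
    "('v::real_vector \<Rightarrow> 'v \<Rightarrow> real) \<Rightarrow> 'v \<times> 'v \<Rightarrow> 'v \<times> 'v \<Rightarrow> complex" where
  "complexify_form B x y =
     Complex (B (fst x) (fst y) - B (snd x) (snd y)) (B (fst x) (snd y) + B (snd x) (fst y))"

(* In a null frame m, the vectors m 0 and m 1 are \<ell> and n. The values m A with
   N \<le> A are irrelevant. *)

definition null_frame ::
    "('f::field \<Rightarrow> 'w::ab_group_add \<Rightarrow> 'w) \<Rightarrow> nat \<Rightarrow> ('w \<Rightarrow> 'w \<Rightarrow> 'f) \<Rightarrow> (nat \<Rightarrow> 'w) \<Rightarrow> bool" where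
  "null_frame smul N g m \<longleftrightarrow> basis_family smul N m \<and>
     (\<forall>A<N. \<forall>B<N. g (m A) (m B) = (if {A, B} = {0, 1} \<or> (A = B \<and> 2 \<le> A) then 1 else 0))"

abbreviation real_null_frame ::
    "nat \<Rightarrow> ('v::real_vector \<Rightarrow> 'v \<Rightarrow> real) \<Rightarrow> (nat \<Rightarrow> 'v) \<Rightarrow> bool" where
  "real_null_frame \<equiv> null_frame (*\<^sub>R)"

abbreviation complex_null_frame ::
    "nat \<Rightarrow> ('v::real_vector \<Rightarrow> 'v \<Rightarrow> real) \<Rightarrow> (nat \<Rightarrow> 'v \<times> 'v) \<Rightarrow> bool" where
  "complex_null_frame N \<eta> \<equiv> null_frame complexify_scale N (complexify_form \<eta>)"

(* Alignment types relative to a class F of frames. *)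

definition alignment_type_0 ::
    "((nat \<Rightarrow> 'w) \<Rightarrow> bool) \<Rightarrow> nat \<Rightarrow> ('w \<Rightarrow> 'w \<Rightarrow> 'f::zero) \<Rightarrow> bool" where
  "alignment_type_0 F N K \<longleftrightarrow> K \<noteq> (\<lambda>x y. 0) \<and>
     (\<forall>m. F m \<longrightarrow> (\<exists>i\<in>{2..<N}. K (m 0) (m i) \<noteq> 0))"

definition alignment_type_2 ::
    "((nat \<Rightarrow> 'w) \<Rightarrow> bool) \<Rightarrow> nat \<Rightarrow> ('w \<Rightarrow> 'w \<Rightarrow> 'f::zero) \<Rightarrow> bool" where
  "alignment_type_2 F N K \<longleftrightarrow> K \<noteq> (\<lambda>x y. 0) \<and>
     (\<exists>m. F m \<and> (\<forall>i\<in>{2..<N}. K (m 0) (m i) = 0) \<and> K (m 0) (m 1) = 0 \<and>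
        (\<forall>i\<in>{2..<N}. \<forall>j\<in>{2..<N}. K (m i) (m j) = 0))"

definition alignment_type_11 ::
    "((nat \<Rightarrow> 'w) \<Rightarrow> bool) \<Rightarrow> nat \<Rightarrow> ('w \<Rightarrow> 'w \<Rightarrow> 'f::zero) \<Rightarrow> bool" where
  "alignment_type_11 F N K \<longleftrightarrow> K \<noteq> (\<lambda>x y. 0) \<and> \<not> alignment_type_2 F N K \<and>
     (\<exists>m. F m \<and> (\<forall>i\<in>{2..<N}. K (m 0) (m i) = 0 \<and> K (m 1) (m i) = 0))"

abbreviation real_alignment_type_0 ::
    "nat \<Rightarrow> ('v::real_vector \<Rightarrow> 'v \<Rightarrow> real) \<Rightarrow> ('v \<Rightarrow> 'v \<Rightarrow> real) \<Rightarrow> bool" where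
  "real_alignment_type_0 N \<eta> K \<equiv> alignment_type_0 (real_null_frame N \<eta>) N K"

abbreviation complex_alignment_type_11 ::
    "nat \<Rightarrow> ('v::real_vector \<Rightarrow> 'v \<Rightarrow> real) \<Rightarrow> ('v \<Rightarrow> 'v \<Rightarrow> real) \<Rightarrow> bool" where
  "complex_alignment_type_11 N \<eta> K \<equiv>
     alignment_type_11 (complex_null_frame N \<eta>) N (complexify_form K)"

(* u_[a w_b] for vectors u, w with indices lowered by \<eta>; the antisymmetrization
   carries the factor 1/2. *)

definition lowered_wedge ::
    "('v \<Rightarrow> 'v \<Rightarrow> real) \<Rightarrow> 'v \<Rightarrow> 'v \<Rightarrow> 'v \<Rightarrow> 'v \<Rightarrow> real" where
  "lowered_wedge \<eta> u w x y = (\<eta> u x * \<eta> w y - \<eta> u y * \<eta> w x) / 2"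

end

(* Write K(x,y) = \<eta>(F x, y) with F skew. K has real type 0 iff F has no null eigenvector. In that case
   \<eta>(F x, F x) is positive on null vectors, so \<eta>(F x, F x) / (- \<eta>(x,x)) attains its minimum \<mu> over the
   time-like cone at some x, and F (F x) = \<mu> x. If \<mu> > 0, then F x + sqrt \<mu> x is a null eigenvector;
   hence F x = 0. So K lives on the Euclidean complement of a time-like vector k, where the normal
   form of skew maps gives planes spanned by (f 0, f 1), (f 2, f 3), ... The real frame is made of
   (f 0 \<plusminus> k) / sqrt 2, f 2, f 3, ..., f 1, the complex one of (f 0 \<plusminus> i f 1) / sqrt 2, f 2, f 3, ..., i k. *)

theory Submission
  imports Defs
begin

section \<open>Symmetric bilinear forms\<close>

text \<open>The time-like cone is not compact modulo scaling, so the infimum of the quotient could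
  be approached only along a null direction. The absence of null eigenvectors prevents this: by
  skewness \<open>F x\<close> is orthogonal to \<open>x\<close>, and for a non-zero null
  \<open>x\<close> the orthogonal vectors of square zero are the multiples of \<open>x\<close>, so
  the numerator stays positive where the denominator vanishes. With \<open>\<mu>\<close> the
  minimum, the symmetric form \<open>\<eta> (F u) (F v) + \<mu> * \<eta> u v\<close> is nonnegative
  near the minimizer and zero at it, so the minimizer lies in its radical; skewness turns this into
  the equation for \<open>F (F x)\<close>. Oddness of \<open>N\<close> makes the Euclidean
  complement of \<open>k\<close> even-dimensional, so the planes of \<open>F\<close> exhaust it; one
  of them together with \<open>k\<close> carries the two null vectors and the last frame vector.
  Complex type 2 is impossible because it would write \<open>K\<close> as a wedge with a null
  covector whose vector lies in the kernel of \<open>K\<close> and is therefore orthogonal to every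
  plane on which \<open>K\<close> is non-zero.\<close>

text \<open>Pairing a relation among the \<open>m A\<close> with \<open>m' B\<close> isolates one
  coefficient. The scalar field is left abstract because frames are needed over the reals and over
  the complex numbers; \<open>m'\<close> may differ from \<open>m\<close> because the two null
  vectors of a frame are dual to each other.\<close>

lemma (in vector_space) dual_family_independent:
  assumes add: "\<And>x y z. g (x + y) z = g x z + g y z"
    and scale: "\<And>c x z. g (scale c x) z = c * g x z"
    and dual: "\<And>A B :: nat. A < n \<Longrightarrow> B < n \<Longrightarrow> g (m A) (m' B) = (if A = B then 1 else 0)"
  shows "inj_on m {..<n}" and "independent (m ` {..<n})"
proof -
  show inj: "inj_on m {..<n}"
  proof (rule inj_onI)
    fix A B :: nat assume "A \<in> {..<n}" "B \<in> {..<n}" "m A = m B"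
    then show "A = B"
      using dual[of A B] dual[of B B] by (auto split: if_splits)
  qed
  have False if A: "A < n" and "m A \<in> span (m ` {..<n} - {m A})" for A
  proof -
    have zero: "g 0 z = 0" for z
      using scale[of 0 0 z] by simp
    have "subspace {x. g x (m' A) = 0}"
      by (rule subspaceI) (simp_all add: zero add scale)
    moreover have "m ` {..<n} - {m A} \<subseteq> {x. g x (m' A) = 0}"
      using dual A by auto
    ultimately have "g (m A) (m' A) = 0"
      using that span_minimal by blast
    then show False
      using dual[OF A A] by simp
  qed
  then show "independent (m ` {..<n})"
    by (auto simp: dependent_def)
qed

locale symmetric_form =
  fixes g :: "'v::real_vector \<Rightarrow> 'v \<Rightarrow> real"
  assumes bilinear: "bilinear g"
    and commute: "g x y = g y x"
begin

lemmas form_simps =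
  bilinear_ladd[OF bilinear] bilinear_radd[OF bilinear]
  bilinear_lmul[OF bilinear] bilinear_rmul[OF bilinear]
  bilinear_lneg[OF bilinear] bilinear_rneg[OF bilinear]
  bilinear_lsub[OF bilinear] bilinear_rsub[OF bilinear]
  bilinear_lzero[OF bilinear] bilinear_rzero[OF bilinear]

lemma form_sum_left: "g (\<Sum>i\<in>A. f i) y = (\<Sum>i\<in>A. g (f i) y)"
  using bilinear linear_sum[of "\<lambda>x. g x y" f A] by (simp add: bilinear_def)

lemma form_sum_right: "g y (\<Sum>i\<in>A. f i) = (\<Sum>i\<in>A. g y (f i))"
  by (simp add: commute[of y] form_sum_left)

definition orthonormal :: "nat \<Rightarrow> (nat \<Rightarrow> 'v) \<Rightarrow> bool" where
  "orthonormal n f \<longleftrightarrow> (\<forall>i<n. \<forall>j<n. g (f i) (f j) = (if i = j then 1 else 0))"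

lemma orthonormal_independent:
  assumes "orthonormal n f"
  shows "inj_on f {..<n}" and "independent (f ` {..<n})"
  using real_vector.dual_family_independent[of g n f f] assms
  by (simp_all add: form_simps orthonormal_def)

lemma orthonormal_expansion:
  assumes "orthonormal n f" and "x \<in> span (f ` {..<n})"
  shows "x = (\<Sum>i<n. g x (f i) *\<^sub>R f i)"
  using assms(2)
proof (induction rule: span_induct_alt)
  case base
  then show ?case by (simp add: form_simps)
next
  case (step c x y)
  then obtain j where j: "j < n" "x = f j" by auto
  have "(\<Sum>i<n. g (f j) (f i) *\<^sub>R f i) = (\<Sum>i<n. if j = i then f i else 0)"
    using assms(1) j(1) by (intro sum.cong) (auto simp: orthonormal_def)
  also have "\<dots> = f j" using j(1) by simp
  finally have fj: "(\<Sum>i<n. g (f j) (f i) *\<^sub>R f i) = f j" .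
  have "(\<Sum>i<n. g (c *\<^sub>R x + y) (f i) *\<^sub>R f i) =
      c *\<^sub>R (\<Sum>i<n. g (f j) (f i) *\<^sub>R f i) + (\<Sum>i<n. g y (f i) *\<^sub>R f i)"
    by (simp add: form_simps j(2) scaleR_add_left sum.distrib scaleR_right.sum)
  then show ?case
    using fj step(2) j(2) by simp
qed

lemma orthonormal_comb_coeff:
  assumes "orthonormal n f" "j < n"
  shows "g (\<Sum>i<n. a i *\<^sub>R f i) (f j) = a j"
proof -
  have "g (\<Sum>i<n. a i *\<^sub>R f i) (f j) = (\<Sum>i<n. if i = j then a i else 0)"
    unfolding form_sum_left using assms
    by (intro sum.cong) (auto simp: orthonormal_def form_simps)
  then show ?thesis using assms(2) by simp
qed

lemma orthonormal_comb_form: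
  assumes "orthonormal n f"
  shows "g (\<Sum>i<n. a i *\<^sub>R f i) (\<Sum>i<n. b i *\<^sub>R f i) = (\<Sum>i<n. a i * b i)"
proof -
  have "g (\<Sum>i<n. a i *\<^sub>R f i) (\<Sum>i<n. b i *\<^sub>R f i) = (\<Sum>j<n. b j * g (\<Sum>i<n. a i *\<^sub>R f i) (f j))"
    by (simp only: form_sum_right[where f="\<lambda>i. b i *\<^sub>R f i"] form_simps) simp
  also have "\<dots> = (\<Sum>j<n. b j * a j)"
    by (intro sum.cong) (auto simp: orthonormal_comb_coeff[OF assms])
  finally show ?thesis by (simp add: mult.commute)
qed

lemma gram_schmidt_step:
  assumes W: "subspace W" and pos: "\<And>x. x \<in> W \<Longrightarrow> x \<noteq> 0 \<Longrightarrow> 0 < g x x"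
    and f: "orthonormal m f" "f ` {..<m} \<subseteq> W"
    and w: "w \<in> W" "w \<notin> span (f ` {..<m})"
  obtains v where "v \<in> W" "orthonormal (Suc m) (f(m := v))"
proof -
  define p where "p = (\<Sum>i<m. g w (f i) *\<^sub>R f i)"
  define u where "u = w - p"
  have p_span: "p \<in> span (f ` {..<m})"
    unfolding p_def by (intro span_sum span_scale span_base) auto
  then have "u \<noteq> 0"
    using w(2) by (auto simp: u_def)
  have "p \<in> W"
    unfolding p_def using f(2) by (intro subspace_sum[OF W] subspace_scale[OF W]) auto
  then have "u \<in> W"
    unfolding u_def using w(1) W by (simp add: subspace_diff)
  have uf: "g u (f j) = 0" if "j < m" for j
    using orthonormal_comb_coeff[OF f(1) that] by (simp add: u_def p_def form_simps)
  have pos_u: "0 < g u u" using pos \<open>u \<in> W\<close> \<open>u \<noteq> 0\<close> by blast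
  define v where "v = (1 / sqrt (g u u)) *\<^sub>R u"
  have "v \<in> W" using \<open>u \<in> W\<close> W by (simp add: v_def subspace_scale)
  moreover have "g v v = 1" using pos_u by (simp add: v_def form_simps)
  moreover have "g v (f j) = 0" "g (f j) v = 0" if "j < m" for j
    using uf[OF that] commute[of "f j" v] by (simp_all add: v_def form_simps)
  ultimately show thesis
    using f(1) by (intro that[of v]) (auto simp: orthonormal_def less_Suc_eq)
qed

text \<open>Gram-Schmidt terminates because orthonormal families are independent and hence no longer
  than \<open>B\<close>. Positivity is demanded on \<open>W\<close> alone since \<open>g\<close> may
  be indefinite, and the given vectors stay an initial segment so that prescribed directions
  survive.\<close>

lemma orthonormal_basis_extension:
  assumes B: "finite B" "span B = (UNIV :: 'v set)"
    and W: "subspace W" and pos: "\<And>x. x \<in> W \<Longrightarrow> x \<noteq> 0 \<Longrightarrow> 0 < g x x"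
    and f: "orthonormal m f" "f ` {..<m} \<subseteq> W"
  obtains f' where "m \<le> dim W" "\<And>i. i < m \<Longrightarrow> f' i = f i" "f' ` {..<dim W} \<subseteq> W"
    "orthonormal (dim W) f'" "span (f' ` {..<dim W}) = W"
proof -
  have bound: "n \<le> card B" if "orthonormal n h" for n h
    using real_vector.independent_span_bound[OF B(1) orthonormal_independent(2)[OF that]] B(2)
      card_image[OF orthonormal_independent(1)[OF that]] by simp
  have "\<exists>f' n. m \<le> n \<and> (\<forall>i<m. f' i = f i) \<and> f' ` {..<n} \<subseteq> W \<and> orthonormal n f' \<and> span (f' ` {..<n}) = W"
    using f
  proof (induction "card B - m" arbitrary: m f rule: less_induct)
    case less
    show ?case
    proof (cases "W \<subseteq> span (f ` {..<m})")
      case True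
      then have "span (f ` {..<m}) = W"
        using less.prems(2) W by (simp add: span_minimal subset_antisym)
      then show ?thesis using less.prems by blast
    next
      case False
      then obtain w where "w \<in> W" "w \<notin> span (f ` {..<m})" by blast
      then obtain v where v: "v \<in> W" "orthonormal (Suc m) (f(m := v))"
        using gram_schmidt_step[OF W pos less.prems] by blast
      have "card B - Suc m < card B - m"
        using bound[OF v(2)] by simp
      moreover have "(f(m := v)) ` {..<Suc m} \<subseteq> W"
        using v(1) less.prems(2) by (auto simp: less_Suc_eq)
      ultimately obtain f' n where *: "Suc m \<le> n" "\<forall>i<Suc m. f' i = (f(m := v)) i"
          "f' ` {..<n} \<subseteq> W" "orthonormal n f'" "span (f' ` {..<n}) = W"
        using less.hyps[of "Suc m" "f(m := v)"] v(2) by blast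
      have "\<forall>i<m. f' i = f i" using *(2) by simp
      then show ?thesis using * by (intro exI[of _ f'] exI[of _ n]) simp
    qed
  qed
  then obtain f' n where *: "m \<le> n" "\<forall>i<m. f' i = f i" "f' ` {..<n} \<subseteq> W" "orthonormal n f'"
    "span (f' ` {..<n}) = W" by blast
  have "dim W = n"
    using dim_span_eq_card_independent[OF orthonormal_independent(2)[OF *(4)]]
      card_image[OF orthonormal_independent(1)[OF *(4)]] *(5) by simp
  then show thesis using * that by blast
qed

end

section \<open>Minima of quadratic forms and their first-order condition\<close>

text \<open>The type \<open>'v\<close> carries no topology, so spheres are parametrized by
  coefficient sequences. Forcing zeros from index \<open>n\<close> on places the set in a cube that
  is compact by Tychonoff.\<close>

lemma compact_unit_coefficients:
  "compact {a :: nat \<Rightarrow> real. (\<Sum>i<n. (a i)\<^sup>2) = 1 \<and> (\<forall>i\<ge>n. a i = 0)}" (is "compact ?S")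
proof -
  have "compactin (product_topology (\<lambda>i. euclidean) UNIV) (PiE UNIV (\<lambda>i::nat. {-1..1::real}))"
    by (subst compactin_PiE) auto
  then have c: "compact (PiE UNIV (\<lambda>i::nat. {-1..1::real}))"
    by (simp add: euclidean_product_topology)
  have "closed {a :: nat \<Rightarrow> real. (\<Sum>i<n. (a i)\<^sup>2) = 1}"
    by (intro closed_Collect_eq continuous_intros) auto
  moreover have "closed {a :: nat \<Rightarrow> real. \<forall>i\<ge>n. a i = 0}"
    by (intro closed_Collect_all closed_Collect_imp open_Collect_const closed_Collect_eq continuous_intros) auto
  ultimately have "closed ?S"
    by (simp add: Collect_conj_eq closed_Int)
  moreover have "?S \<subseteq> PiE UNIV (\<lambda>i::nat. {-1..1::real})"
  proof
    fix a assume a: "a \<in> ?S"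
    have "\<bar>a i\<bar> \<le> 1" for i
    proof (cases "i < n")
      case True
      then have "(a i)\<^sup>2 \<le> (\<Sum>i<n. (a i)\<^sup>2)" by (intro member_le_sum) auto
      then show ?thesis using a by (simp add: abs_square_le_1)
    qed (use a in auto)
    then show "a \<in> PiE UNIV (\<lambda>i::nat. {-1..1::real})"
      by (auto simp: PiE_def Pi_def abs_le_iff minus_le_iff)
  qed
  ultimately show ?thesis
    using compact_Int_closed[OF c, of ?S] by (simp only: Int_absorb1)
qed

text \<open>The forms are continuous in the coefficients, so compactness gives the minimum. The
  constraint \<open>H\<close> serves two uses: the zero form leaves the whole sphere, the Lorentz
  form cuts out its causal part.\<close>

lemma (in symmetric_form) quadratic_attains_min_on_sphere:
  assumes f: "orthonormal n f" and Q: "bilinear (Q :: 'v \<Rightarrow> 'v \<Rightarrow> real)"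
    and H: "bilinear (H :: 'v \<Rightarrow> 'v \<Rightarrow> real)"
    and S: "S = {x \<in> span (f ` {..<n}). g x x = 1 \<and> H x x \<le> 0}" and "S \<noteq> {}"
  obtains x where "x \<in> S" "\<And>y. y \<in> S \<Longrightarrow> Q x x \<le> Q y y"
proof -
  define \<phi> where "\<phi> a = (\<Sum>i<n. a i *\<^sub>R f i)" for a :: "nat \<Rightarrow> real"
  define T where "T = {a :: nat \<Rightarrow> real. (\<Sum>i<n. (a i)\<^sup>2) = 1 \<and> (\<forall>i\<ge>n. a i = 0)} \<inter> {a. H (\<phi> a) (\<phi> a) \<le> 0}"
  have cont: "continuous_on UNIV (\<lambda>a. B (\<phi> a) (\<phi> a))" if "bilinear B"
    for B :: "'v \<Rightarrow> 'v \<Rightarrow> real"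
    unfolding \<phi>_def bilinear_sum[OF that] case_prod_beta bilinear_lmul[OF that] bilinear_rmul[OF that]
    by (intro continuous_intros) auto
  have "closed {a. H (\<phi> a) (\<phi> a) \<le> 0}"
    using cont[OF H] by (intro closed_Collect_le continuous_intros)
  then have "compact T"
    unfolding T_def by (intro compact_Int_closed compact_unit_coefficients)
  have T_iff: "\<phi> a \<in> S" if "a \<in> T" for a
  proof -
    have "\<phi> a \<in> span (f ` {..<n})"
      unfolding \<phi>_def by (intro span_sum span_scale span_base) auto
    then show ?thesis
      using that orthonormal_comb_form[OF f, of a a]
      by (simp add: S T_def \<phi>_def power2_eq_square)
  qed
  have S_T: "\<exists>a\<in>T. x = \<phi> a" if "x \<in> S" for x
  proof -
    define a where "a i = (if i < n then g x (f i) else 0)" for i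
    have x: "x = \<phi> a"
      using orthonormal_expansion[OF f] that by (auto simp: S \<phi>_def a_def)
    moreover have "a \<in> T"
      using that orthonormal_comb_form[OF f, of a a] x
      by (auto simp: S T_def \<phi>_def[symmetric] power2_eq_square) (simp add: a_def)
    ultimately show ?thesis by blast
  qed
  then have "T \<noteq> {}" using \<open>S \<noteq> {}\<close> by blast
  then obtain a where "a \<in> T" "\<And>b. b \<in> T \<Longrightarrow> Q (\<phi> a) (\<phi> a) \<le> Q (\<phi> b) (\<phi> b)"
    using continuous_attains_inf[OF \<open>compact T\<close> _ continuous_on_subset[OF cont[OF Q]]] by auto
  then show thesis using that T_iff S_T by metis
qed

text \<open>The first-order condition at a minimum: along the line through \<open>x\<close> in
  direction \<open>y\<close> the form is a polynomial in \<open>t\<close> with derivative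
  \<open>2 * g x y\<close> at 0. Nonnegativity is local because a line through a time-like
  \<open>x\<close> may leave the time-like cone.\<close>

lemma (in symmetric_form) semidefinite_null_orthogonal:
  assumes nonneg: "\<forall>\<^sub>F t in nhds 0. 0 \<le> g (x + t *\<^sub>R y) (x + t *\<^sub>R y)" and "g x x = 0"
  shows "g x y = 0"
proof -
  let ?q = "\<lambda>t::real. 2 * t * g x y + t\<^sup>2 * g y y"
  have q: "g (x + t *\<^sub>R y) (x + t *\<^sub>R y) = ?q t" for t
    using assms(2) by (simp add: form_simps commute[of y x] power2_eq_square algebra_simps)
  obtain d where d: "d > 0" "\<And>t. dist t 0 < d \<Longrightarrow> 0 \<le> ?q t"
    using nonneg unfolding q eventually_nhds_metric by blast
  have "(?q has_real_derivative 2 * g x y) (at 0)"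
    by (auto intro!: derivative_eq_intros)
  then have "2 * g x y = 0"
    by (rule DERIV_local_min[OF _ d(1)]) (use d(2) in \<open>auto simp: dist_real_def\<close>)
  then show ?thesis by simp
qed

section \<open>Lorentz spaces\<close>

locale lorentz_space = symmetric_form \<eta> for \<eta> :: "'v::real_vector \<Rightarrow> 'v \<Rightarrow> real" +
  fixes N :: nat
  assumes N_ge: "3 \<le> N" and lorentzian: "lorentzian N \<eta>"
begin

text \<open>The time-like vector is kept apart from the space-like ones so that the Euclidean
  results on \<open>orthonormal\<close> families apply to \<open>f\<close> directly.\<close>

definition lorentz_frame :: "'v \<Rightarrow> (nat \<Rightarrow> 'v) \<Rightarrow> bool" where
  "lorentz_frame k f \<longleftrightarrow> \<eta> k k = -1 \<and> (\<forall>i<N - 1. \<eta> k (f i) = 0) \<and> orthonormal (N - 1) f \<and>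
     span (insert k (f ` {..<N - 1})) = UNIV"

lemma lorentz_frameD:
  assumes "lorentz_frame k f"
  shows "\<eta> k k = -1" "i < N - 1 \<Longrightarrow> \<eta> k (f i) = 0" "i < N - 1 \<Longrightarrow> \<eta> (f i) k = 0"
    "i < N - 1 \<Longrightarrow> j < N - 1 \<Longrightarrow> \<eta> (f i) (f j) = (if i = j then 1 else 0)"
proof -
  show "\<eta> k k = -1" "i < N - 1 \<Longrightarrow> \<eta> k (f i) = 0"
    "i < N - 1 \<Longrightarrow> j < N - 1 \<Longrightarrow> \<eta> (f i) (f j) = (if i = j then 1 else 0)"
    using assms unfolding lorentz_frame_def orthonormal_def by blast+
  then show "i < N - 1 \<Longrightarrow> \<eta> (f i) k = 0"
    by (subst commute) blast
qed

lemma lorentz_frame_expansion: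
  assumes "lorentz_frame k f"
  shows "x = (- \<eta> x k) *\<^sub>R k + (\<Sum>i<N - 1. \<eta> x (f i) *\<^sub>R f i)"
proof -
  have "x \<in> span (insert k (f ` {..<N - 1}))"
    using assms by (simp add: lorentz_frame_def)
  then obtain c where c: "x - c *\<^sub>R k \<in> span (f ` {..<N - 1})"
    by (auto simp: span_breakdown_eq)
  define y where "y = x - c *\<^sub>R k"
  have y: "y = (\<Sum>i<N - 1. \<eta> y (f i) *\<^sub>R f i)"
    using orthonormal_expansion[of "N - 1" f y] assms c by (simp add: y_def lorentz_frame_def)
  have "\<eta> (\<Sum>i<N - 1. \<eta> y (f i) *\<^sub>R f i) k = 0"
    unfolding form_sum_left by (intro sum.neutral) (simp add: form_simps lorentz_frameD[OF assms])
  then have yk: "\<eta> y k = 0"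
    by (simp only: y[symmetric])
  have x: "x = c *\<^sub>R k + y" by (simp add: y_def)
  have xk: "\<eta> x k = - c" using yk by (simp add: x form_simps lorentz_frameD[OF assms])
  have "(\<Sum>i<N - 1. \<eta> x (f i) *\<^sub>R f i) = (\<Sum>i<N - 1. \<eta> y (f i) *\<^sub>R f i)"
    by (intro sum.cong) (simp_all add: x form_simps lorentz_frameD[OF assms])
  then have "(\<Sum>i<N - 1. \<eta> x (f i) *\<^sub>R f i) = y" using y by (rule trans[OF _ sym])
  then show ?thesis using xk by (simp add: y_def)
qed

lemma lorentz_frame_form:
  assumes "lorentz_frame k f"
  shows "\<eta> x y = - (\<eta> x k * \<eta> y k) + (\<Sum>i<N - 1. \<eta> x (f i) * \<eta> y (f i))"
proof -
  have "\<eta> x y = \<eta> x ((- \<eta> y k) *\<^sub>R k + (\<Sum>i<N - 1. \<eta> y (f i) *\<^sub>R f i))"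
    by (rule arg_cong[OF lorentz_frame_expansion[OF assms]])
  then show ?thesis by (simp add: form_simps form_sum_right mult.commute)
qed

lemma base_frame_exists: obtains k f where "lorentz_frame k f"
proof -
  obtain e where e: "basis_family (*\<^sub>R) N e"
    and orth: "\<And>A B. A < N \<Longrightarrow> B < N \<Longrightarrow> \<eta> (e A) (e B) = (if A \<noteq> B then 0 else if A = 0 then - 1 else 1)"
    using lorentzian by (auto simp: lorentzian_def)
  have N: "N = Suc (N - 1)" using N_ge by simp
  have "e ` {..<N} = insert (e 0) ((e \<circ> Suc) ` {..<N - 1})"
    by (subst N, subst lessThan_Suc_eq_insert_0) (simp add: image_comp)
  moreover have "span (e ` {..<N}) = UNIV"
    using e by (simp add: basis_family_def span_raw_def)
  ultimately have "lorentz_frame (e 0) (e \<circ> Suc)"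
    using N_ge by (auto simp: lorentz_frame_def orthonormal_def orth)
  then show thesis by (rule that)
qed

lemma finite_basis: obtains B where "finite B" "span B = (UNIV :: 'v set)" "card B = N" "dim (UNIV :: 'v set) = N"
proof -
  obtain e :: "nat \<Rightarrow> 'v" where e: "basis_family (*\<^sub>R) N e"
    using lorentzian unfolding lorentzian_def by blast
  then have s: "span (e ` {..<N}) = UNIV" and c: "card (e ` {..<N}) = N"
    by (simp_all add: basis_family_def span_raw_def card_image)
  have "dim (UNIV :: 'v set) = card (e ` {..<N})"
    using e s by (intro dim_eq_card) (simp_all add: basis_family_def dependent_raw_def)
  then show thesis using s c by (intro that[of "e ` {..<N}"]) auto
qed

lemma nondegenerate:
  assumes "\<And>y. \<eta> x y = 0" shows "x = 0"
proof -
  obtain k f where kf: "lorentz_frame k f" by (rule base_frame_exists)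
  show ?thesis
    by (rule trans[OF lorentz_frame_expansion[OF kf]]) (simp add: assms)
qed

lemma frame_orthogonal_positive:
  assumes "lorentz_frame k f" "\<eta> z k = 0"
  shows "0 \<le> \<eta> z z" and "\<eta> z z = 0 \<Longrightarrow> z = 0"
proof -
  have eq: "\<eta> z z = (\<Sum>i<N - 1. (\<eta> z (f i))\<^sup>2)"
    by (subst lorentz_frame_form[OF assms(1)]) (simp add: assms(2) power2_eq_square)
  then show "0 \<le> \<eta> z z" by (simp add: sum_nonneg)
  assume "\<eta> z z = 0"
  then have "\<forall>i<N - 1. \<eta> z (f i) = 0"
    using eq by (simp add: sum_nonneg_eq_0_iff)
  then have "(- \<eta> z k) *\<^sub>R k + (\<Sum>i<N - 1. \<eta> z (f i) *\<^sub>R f i) = 0"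
    using assms(2) by simp
  then show "z = 0"
    using lorentz_frame_expansion[OF assms(1), of z] by (rule trans[rotated])
qed

text \<open>Subtracting a suitable multiple of the causal vector \<open>x\<close> moves \<open>y\<close> into the Euclidean
  complement of a fixed time-like vector.\<close>

lemma orthogonal_to_causal:
  assumes "x \<noteq> 0" "\<eta> x x \<le> 0" "\<eta> x y = 0"
  shows "0 \<le> \<eta> y y" and "\<eta> y y = 0 \<Longrightarrow> \<exists>c. y = c *\<^sub>R x"
proof -
  obtain k f where kf: "lorentz_frame k f" by (rule base_frame_exists)
  have xk: "\<eta> x k \<noteq> 0"
    using frame_orthogonal_positive[OF kf, of x] assms(1,2) by auto
  define c where "c = \<eta> y k / \<eta> x k"
  define z where "z = y - c *\<^sub>R x"
  have zk: "\<eta> z k = 0" using xk by (simp add: z_def c_def form_simps)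
  have zz: "\<eta> z z = \<eta> y y + c\<^sup>2 * \<eta> x x"
    using assms(3) commute[of y x] by (simp add: z_def form_simps power2_eq_square algebra_simps)
  have neg: "c\<^sup>2 * \<eta> x x \<le> 0" using assms(2) by (simp add: mult_nonneg_nonpos)
  show "0 \<le> \<eta> y y" using frame_orthogonal_positive(1)[OF kf zk] zz neg by simp
  assume "\<eta> y y = 0"
  then have "z = 0"
    using frame_orthogonal_positive[OF kf zk] zz neg by simp
  then show "\<exists>c. y = c *\<^sub>R x" by (auto simp: z_def)
qed

lemma orthogonal_to_timelike:
  assumes "\<eta> x x < 0" "\<eta> x y = 0" "y \<noteq> 0"
  shows "0 < \<eta> y y"
proof -
  have x: "x \<noteq> 0" using assms(1) by (auto simp: form_simps)
  have "\<eta> y y \<noteq> 0"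
  proof
    assume "\<eta> y y = 0"
    then obtain c where "y = c *\<^sub>R x"
      using orthogonal_to_causal(2)[OF x _ assms(2)] assms(1) by auto
    then show False using assms by (simp add: form_simps)
  qed
  then show ?thesis using orthogonal_to_causal(1)[OF x _ assms(2)] assms(1) by simp
qed

lemma subspace_orthogonal: "subspace {x. \<eta> k x = 0}"
  by (rule subspaceI) (simp_all add: form_simps)

text \<open>An orthonormal basis of the Euclidean complement of \<open>k\<close> is grown from
  \<open>f\<close>; together with \<open>k\<close> it is a basis of the whole space, so a dimension
  count gives it exactly \<open>N - 1\<close> members.\<close>

lemma lorentz_frame_extension:
  assumes k: "\<eta> k k = -1" and f: "orthonormal m f" "\<And>i. i < m \<Longrightarrow> \<eta> k (f i) = 0"
  obtains f' where "lorentz_frame k f'" "\<And>i. i < m \<Longrightarrow> f' i = f i"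
proof -
  define W where "W = {x. \<eta> k x = 0}"
  obtain B where B: "finite B" "span B = (UNIV :: 'v set)" and dimN: "dim (UNIV :: 'v set) = N"
    by (rule finite_basis)
  have pos: "0 < \<eta> x x" if "x \<in> W" "x \<noteq> 0" for x
    using orthogonal_to_timelike[of k x] k that by (simp add: W_def)
  have W: "subspace W" unfolding W_def by (rule subspace_orthogonal)
  have fW: "f ` {..<m} \<subseteq> W" using f(2) by (auto simp: W_def)
  obtain f' where f': "\<And>i. i < m \<Longrightarrow> f' i = f i" "f' ` {..<dim W} \<subseteq> W"
    "orthonormal (dim W) f'" "span (f' ` {..<dim W}) = W"
    by (rule orthonormal_basis_extension[OF B W pos f(1) fW]) blast+
  let ?F = "f' ` {..<dim W}"
  have kW: "k \<notin> W" using k by (simp add: W_def)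
  then have ind: "independent (insert k ?F)"
    using orthonormal_independent(2)[OF f'(3)] f'(4) by (simp add: independent_insertI)
  have all: "span (insert k ?F) = UNIV"
  proof -
    have "x \<in> span (insert k ?F)" for x
    proof -
      \<comment> \<open>Projection along \<open>k\<close> onto its complement; the plus sign comes
        from \<open>\<eta> k k = -1\<close>.\<close>
      have "x + \<eta> k x *\<^sub>R k \<in> W" by (simp add: W_def form_simps k)
      then show ?thesis
        using f'(4) unfolding span_breakdown_eq by (intro exI[of _ "- \<eta> k x"]) simp
    qed
    then show ?thesis by blast
  qed
  have "k \<notin> ?F" using kW f'(2) by blast
  then have "card (insert k ?F) = Suc (dim W)"
    using card_image[OF orthonormal_independent(1)[OF f'(3)]] by simp
  moreover have "dim (UNIV :: 'v set) = card (insert k ?F)"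
    using ind all by (intro dim_eq_card) simp_all
  ultimately have dimW: "dim W = N - 1" using dimN by simp
  have "\<forall>i<N - 1. \<eta> k (f' i) = 0"
    using f'(2) unfolding dimW by (auto simp: W_def)
  then have "lorentz_frame k f'"
    using k f'(3) all unfolding lorentz_frame_def dimW by blast
  then show thesis using that f'(1) by blast
qed

text \<open>Raising an index: \<open>F x\<close> has the frame components of the covector
  \<open>K x\<close>, except that the one along \<open>k\<close> changes sign because
  \<open>k\<close> has square -1.\<close>

lemma bivector_endomorphism:
  assumes "bivector K"
  obtains F where "linear F" "\<And>x y. \<eta> (F x) y = K x y"
proof -
  have K: "bilinear K" using assms by (simp add: bivector_def)
  obtain k f where kf: "lorentz_frame k f" by (rule base_frame_exists)
  define F where "F x = (- K x k) *\<^sub>R k + (\<Sum>i<N - 1. K x (f i) *\<^sub>R f i)" for x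
  have "\<eta> (F x) y = K x y" for x y
  proof -
    have "K x y = K x ((- \<eta> y k) *\<^sub>R k + (\<Sum>i<N - 1. \<eta> y (f i) *\<^sub>R f i))"
      by (rule arg_cong[OF lorentz_frame_expansion[OF kf]])
    also have "\<dots> = - \<eta> y k * K x k + (\<Sum>i<N - 1. \<eta> y (f i) * K x (f i))"
    proof -
      have "linear (K x)" using K by (simp add: bilinear_def)
      then show ?thesis
        by (simp only: linear_add linear_sum linear_scale real_scaleR_def)
    qed
    finally show ?thesis
      by (simp add: F_def form_simps form_sum_left commute[of y] mult.commute)
  qed
  moreover have "linear F"
  proof (rule linearI)
    show "F (x + y) = F x + F y" for x y
      by (simp add: F_def bilinear_ladd[OF K] scaleR_add_left scaleR_diff_left sum.distrib)
    show "F (c *\<^sub>R x) = c *\<^sub>R F x" for c x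
      by (simp add: F_def bilinear_lmul[OF K] scaleR_add_right scaleR_diff_right scaleR_right.sum)
  qed
  ultimately show thesis using that by blast
qed

end

section \<open>Normal form of skew maps\<close>

lemma bilinear_scale_square:
  assumes "bilinear (B :: 'v::real_vector \<Rightarrow> 'v \<Rightarrow> real)"
  shows "B (c *\<^sub>R x) (c *\<^sub>R x) = c\<^sup>2 * B x x"
  by (simp add: bilinear_lmul[OF assms] bilinear_rmul[OF assms] power2_eq_square)

context symmetric_form
begin

lemma bilinear_image_form:
  assumes "linear F" shows "bilinear (\<lambda>x y. g (F x) (F y))"
  by (simp add: bilinear_def linear_iff form_simps linear_add[OF assms] linear_scale[OF assms])

lemma skew_self:
  assumes "\<And>x y. g (F x) y = - g x (F y)"
  shows "g x (F x) = 0" and "g (F x) x = 0"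
  using assms[of x x] commute[of x "F x"] by simp_all

text \<open>A unit vector \<open>x\<close> maximizing \<open>g (F x) (F x)\<close> and its image
  span the plane: with \<open>\<mu>\<close> the maximum, the form \<open>p\<close> is semidefinite
  on \<open>W\<close> and null at \<open>x\<close>, which forces
  \<open>F (F x) = - \<mu> x\<close>.\<close>

lemma skew_eigenplane:
  assumes B: "finite B" "span B = (UNIV :: 'v set)"
    and F: "linear F" and skew: "\<And>x y. g (F x) y = - g x (F y)"
    and W: "subspace W" and pos: "\<And>x. x \<in> W \<Longrightarrow> x \<noteq> 0 \<Longrightarrow> 0 < g x x"
    and inv: "\<And>x. x \<in> W \<Longrightarrow> F x \<in> W" and dim: "2 \<le> dim W"
  obtains x y c where "x \<in> W" "y \<in> W" "g x x = 1" "g y y = 1" "g x y = 0"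
    "F x = c *\<^sub>R y" "F y = (- c) *\<^sub>R x"
proof -
  have e0: "orthonormal 0 (\<lambda>_. 0)" "(\<lambda>_::nat. 0) ` {..<0} \<subseteq> W" by (simp_all add: orthonormal_def)
  obtain e where e: "orthonormal (dim W) e" "span (e ` {..<dim W}) = W" and eW: "e ` {..<dim W} \<subseteq> W"
    by (rule orthonormal_basis_extension[OF B W pos e0]) blast+
  have e01: "e 0 \<in> W" "e 1 \<in> W" using eW dim by auto
  have g01: "g (e 0) (e 0) = 1" "g (e 1) (e 1) = 1" "g (e 0) (e 1) = 0"
    using e(1) dim by (auto simp: orthonormal_def)
  \<comment> \<open>The sign turns the maximum sought into a minimum; the zero form below leaves the
    sphere unconstrained.\<close>
  define Q where "Q u v = - g (F u) (F v)" for u v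
  have Q: "bilinear Q"
    by (simp add: Q_def bilinear_def linear_iff form_simps linear_add[OF F] linear_scale[OF F])
  have H: "bilinear (\<lambda>u v::'v. 0::real)" by (simp add: bilinear_def linear_iff)
  define S where "S = {x \<in> span (e ` {..<dim W}). g x x = 1 \<and> (\<lambda>u v::'v. 0::real) x x \<le> 0}"
  have S: "x \<in> S \<longleftrightarrow> x \<in> W \<and> g x x = 1" for x by (simp add: S_def e(2))
  have "S \<noteq> {}" using S[of "e 0"] e01 g01 by blast
  then obtain x where "x \<in> S" and min: "\<And>y. y \<in> S \<Longrightarrow> Q x x \<le> Q y y"
    by (rule quadratic_attains_min_on_sphere[OF e(1) Q H S_def]) blast
  then have x: "x \<in> W" "g x x = 1" by (simp_all add: S)
  define \<mu> where "\<mu> = g (F x) (F x)"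
  have nonneg: "0 \<le> g y y" if "y \<in> W" for y
    using pos[OF that] by (cases "y = 0") (auto simp: form_simps)
  have \<mu>0: "0 \<le> \<mu>" unfolding \<mu>_def using nonneg inv x(1) by blast
  have le: "g (F y) (F y) \<le> \<mu> * g y y" if y: "y \<in> W" for y
  proof (cases "y = 0")
    case True
    then show ?thesis by (simp add: linear_0[OF F] form_simps)
  next
    case False
    then have gy: "0 < g y y" using pos y by blast
    define s where "s = 1 / sqrt (g y y)"
    have s: "s\<^sup>2 = 1 / g y y" using gy by (simp add: s_def power_divide)
    have "s *\<^sub>R y \<in> S"
      using y W gy bilinear_scale_square[OF bilinear, of s y] by (simp add: S subspace_scale s)
    then have "g (F (s *\<^sub>R y)) (F (s *\<^sub>R y)) \<le> \<mu>"
      using min by (fastforce simp: Q_def \<mu>_def)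
    then have "g (F y) (F y) / g y y \<le> \<mu>"
      using bilinear_scale_square[OF bilinear, of s "F y"] by (simp add: linear_scale[OF F] s)
    then show ?thesis using gy by (simp add: field_simps)
  qed
  show thesis
  proof (cases "\<mu> = 0")
    case True
    \<comment> \<open>With maximum 0, \<open>F\<close> vanishes on \<open>W\<close>, so any
      orthonormal pair will do.\<close>
    have "F y = 0" if "y \<in> W" for y
      using le[OF that] pos[OF inv[OF that]] True by fastforce
    then show thesis
      using that[of "e 0" "e 1" 0] e01 g01 by simp
  next
    case False
    with \<mu>0 have \<mu>: "0 < \<mu>" by simp
    define p where "p u v = \<mu> * g u v - g (F u) (F v)" for u v
    interpret p: symmetric_form p
    proof
      show "bilinear p"
        by (simp add: p_def bilinear_def linear_iff form_simps linear_add[OF F] linear_scale[OF F] algebra_simps)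
      show "p u v = p v u" for u v
        by (simp add: p_def commute[of u v] commute[of "F u" "F v"])
    qed
    have p: "p x y = 0" if y: "y \<in> W" for y
    proof (rule p.semidefinite_null_orthogonal)
      have "0 \<le> p (x + t *\<^sub>R y) (x + t *\<^sub>R y)" for t
        using le[of "x + t *\<^sub>R y"] x(1) y W by (simp add: p_def subspace_add subspace_scale)
      then show "\<forall>\<^sub>F t in nhds 0. 0 \<le> p (x + t *\<^sub>R y) (x + t *\<^sub>R y)" by simp
      show "p x x = 0" by (simp add: p_def \<mu>_def x(2))
    qed
    define z where "z = F (F x) + \<mu> *\<^sub>R x"
    have zW: "z \<in> W" using x(1) inv W by (simp add: z_def subspace_add subspace_scale)
    \<comment> \<open>By skewness \<open>p x y = g z y\<close> for every \<open>y\<close>; taking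
      \<open>y = z\<close> shows that \<open>z\<close> has square zero.\<close>
    have "g z z = p x z"
      by (subst z_def) (simp add: p_def form_simps skew)
    then have "z = 0" using p[OF zW] pos[OF zW] by fastforce
    then have FF: "F (F x) = (- \<mu>) *\<^sub>R x" by (simp add: z_def eq_neg_iff_add_eq_0)
    define y where "y = (1 / sqrt \<mu>) *\<^sub>R F x"
    have "sqrt \<mu> * sqrt \<mu> = \<mu>" using \<mu> by simp
    then have "\<mu> / sqrt \<mu> = sqrt \<mu>" using \<mu> by (simp add: field_simps)
    then have "F y = (- sqrt \<mu>) *\<^sub>R x"
      using \<mu> by (simp add: y_def linear_scale[OF F] FF)
    moreover have "F x = sqrt \<mu> *\<^sub>R y" using \<mu> by (simp add: y_def)
    moreover have "g y y = 1" using \<mu> by (simp add: y_def form_simps \<mu>_def[symmetric])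
    moreover have "g x y = 0" by (simp add: y_def form_simps skew_self[OF skew])
    moreover have "y \<in> W" using x(1) inv W by (simp add: y_def subspace_scale)
    ultimately show thesis using that x by blast
  qed
qed

text \<open>Induction on the number of planes: once an eigenplane is split off, its orthogonal
  complement inside \<open>W\<close> is again invariant because \<open>F\<close> is skew.\<close>

lemma skew_normal_form:
  assumes B: "finite B" "span B = (UNIV :: 'v set)"
    and F: "linear F" and skew: "\<And>x y. g (F x) y = - g x (F y)"
    and "subspace W" and "\<And>x. x \<in> W \<Longrightarrow> x \<noteq> 0 \<Longrightarrow> 0 < g x x"
    and "\<And>x. x \<in> W \<Longrightarrow> F x \<in> W" and "dim W = 2 * r"
  shows "\<exists>f c. f ` {..<2 * r} \<subseteq> W \<and> orthonormal (2 * r) f \<and>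
    (\<forall>p<r. F (f (2 * p)) = c p *\<^sub>R f (2 * p + 1) \<and> F (f (2 * p + 1)) = (- c p) *\<^sub>R f (2 * p))"
  using assms(5-8)
proof (induction r arbitrary: W)
  case 0
  then show ?case by (simp add: orthonormal_def)
next
  case (Suc r)
  note W = Suc.prems(1) and pos = Suc.prems(2) and inv = Suc.prems(3)
  obtain x y c where xy: "x \<in> W" "y \<in> W" "g x x = 1" "g y y = 1" "g x y = 0"
    and Fxy: "F x = c *\<^sub>R y" "F y = (- c) *\<^sub>R x"
    by (rule skew_eigenplane[OF B F skew W pos inv]) (use Suc.prems(4) in auto)
  define h where "h i = (if i = 0 then x else y)" for i :: nat
  have h: "orthonormal 2 h" "h ` {..<2} \<subseteq> W"
    using xy commute[of y x] by (auto simp: orthonormal_def h_def less_2_cases_iff)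
  obtain e where e: "\<And>i. i < 2 \<Longrightarrow> e i = h i" "e ` {..<dim W} \<subseteq> W"
    "orthonormal (dim W) e" "span (e ` {..<dim W}) = W"
    by (rule orthonormal_basis_extension[OF B W pos h]) blast+
  have e01: "e 0 = x" "e (Suc 0) = y" using e(1)[of 0] e(1)[of 1] by (simp_all add: h_def)
  define d where "d i = e (Suc (Suc i))" for i
  \<comment> \<open>As the span of the leftover basis vectors it has an evident dimension;
    \<open>W'_iff\<close> identifies it with the complement of \<open>x\<close> and \<open>y\<close>
    in \<open>W\<close>.\<close>
  define W' where "W' = span (d ` {..<2 * r})"
  have dimW: "dim W = Suc (Suc (2 * r))" using Suc.prems(4) by simp
  have d: "orthonormal (2 * r) d"
    using e(3) by (simp add: orthonormal_def dimW d_def)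
  have dW: "d ` {..<2 * r} \<subseteq> W" using e(2) by (auto simp: dimW d_def)
  have W'W: "W' \<subseteq> W" unfolding W'_def using dW W by (rule span_minimal)
  have dxy: "g x (d i) = 0 \<and> g y (d i) = 0" if "i < 2 * r" for i
    using e(3) that unfolding orthonormal_def dimW d_def e01[symmetric] by auto
  have W'_iff: "z \<in> W' \<longleftrightarrow> z \<in> W \<and> g x z = 0 \<and> g y z = 0" for z
  proof
    assume z: "z \<in> W'"
    have "subspace ({z. g x z = 0} \<inter> {z. g y z = 0})"
      by (intro subspace_inter subspaceI) (simp_all add: form_simps)
    moreover have "d ` {..<2 * r} \<subseteq> {z. g x z = 0} \<inter> {z. g y z = 0}"
      using dxy by auto
    ultimately have "W' \<subseteq> {z. g x z = 0} \<inter> {z. g y z = 0}"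
      unfolding W'_def by (intro span_minimal)
    then show "z \<in> W \<and> g x z = 0 \<and> g y z = 0" using z W'W by auto
  next
    assume z: "z \<in> W \<and> g x z = 0 \<and> g y z = 0"
    have "(\<Sum>i<dim W. g z (e i) *\<^sub>R e i) = (\<Sum>i<2 * r. g z (d i) *\<^sub>R d i)"
      using z by (simp add: dimW sum.lessThan_Suc_shift d_def e01 commute[of z] del: sum.lessThan_Suc)
    then have "z = (\<Sum>i<2 * r. g z (d i) *\<^sub>R d i)"
      using orthonormal_expansion[OF e(3), of z] z e(4) by (metis (no_types, lifting))
    moreover have "\<dots> \<in> W'"
      unfolding W'_def by (intro span_sum span_scale span_base) auto
    ultimately show "z \<in> W'" by (rule ssubst)
  qed
  have "dim W' = 2 * r"
    unfolding W'_def using dim_span_eq_card_independent[OF orthonormal_independent(2)[OF d]]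
      card_image[OF orthonormal_independent(1)[OF d]] by simp
  moreover have "subspace W'" by (simp add: W'_def)
  moreover have "F z \<in> W'" if "z \<in> W'" for z
    using that inv skew[of x z] skew[of y z] Fxy by (simp add: W'_iff form_simps)
  moreover have "0 < g z z" if "z \<in> W'" "z \<noteq> 0" for z
    using that W'W pos by blast
  ultimately have "\<exists>f b. f ` {..<2 * r} \<subseteq> W' \<and> orthonormal (2 * r) f \<and>
    (\<forall>p<r. F (f (2 * p)) = b p *\<^sub>R f (2 * p + 1) \<and> F (f (2 * p + 1)) = (- b p) *\<^sub>R f (2 * p))"
    by (intro Suc.IH)
  then obtain f b where f: "f ` {..<2 * r} \<subseteq> W'" "orthonormal (2 * r) f"
    and Ff: "\<And>p. p < r \<Longrightarrow> F (f (2 * p)) = b p *\<^sub>R f (2 * p + 1)"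
      "\<And>p. p < r \<Longrightarrow> F (f (2 * p + 1)) = (- b p) *\<^sub>R f (2 * p)"
    by blast
  \<comment> \<open>The new plane comes first, so vector indices move by two and plane numbers by
    one.\<close>
  define f' where "f' i = (case i of 0 \<Rightarrow> x | Suc 0 \<Rightarrow> y | Suc (Suc j) \<Rightarrow> f j)" for i
  define b' where "b' p = (case p of 0 \<Rightarrow> c | Suc q \<Rightarrow> b q)" for p
  have f'_simps: "f' 0 = x" "f' (Suc 0) = y" "f' (Suc (Suc j)) = f j" for j
    by (simp_all add: f'_def)
  have fxy: "g x (f j) = 0" "g y (f j) = 0" "g (f j) x = 0" "g (f j) y = 0" "f j \<in> W" if "j < 2 * r" for j
    using f(1) that commute[of x "f j"] commute[of y "f j"] W'_iff[of "f j"] by auto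
  have cases: "i = 0 \<or> i = Suc 0 \<or> (\<exists>j<2 * r. i = Suc (Suc j))" if "i < 2 * Suc r" for i
    using that by (cases i rule: nat.exhaust; cases "i - 1" rule: nat.exhaust) auto
  have "f' ` {..<2 * Suc r} \<subseteq> W"
    using cases fxy(5) xy(1,2) by (fastforce simp: f'_simps)
  moreover have "orthonormal (2 * Suc r) f'"
    unfolding orthonormal_def
  proof (intro allI impI)
    fix i j assume "i < 2 * Suc r" "j < 2 * Suc r"
    then have "i = 0 \<or> i = Suc 0 \<or> (\<exists>j<2 * r. i = Suc (Suc j))"
      "j = 0 \<or> j = Suc 0 \<or> (\<exists>i<2 * r. j = Suc (Suc i))"
      using cases by blast+
    then show "g (f' i) (f' j) = (if i = j then 1 else 0)"
      using f(2) xy commute[of y x]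
      by (elim disjE exE conjE) (simp_all add: f'_simps fxy orthonormal_def)
  qed
  moreover have "F (f' (2 * p)) = b' p *\<^sub>R f' (2 * p + 1) \<and> F (f' (2 * p + 1)) = (- b' p) *\<^sub>R f' (2 * p)"
    if "p < Suc r" for p
    using that Ff Fxy by (cases p) (simp_all add: f'_simps b'_def)
  ultimately show ?case by blast
qed

end

section \<open>Bivectors with time-like kernel\<close>

lemma sum_pairs: "(\<Sum>i<2 * r. h i) = (\<Sum>p<r. h (2 * p) + h (2 * p + 1))"
  for h :: "nat \<Rightarrow> 'a::comm_monoid_add"
  by (induction r) (simp_all add: add.assoc)

context lorentz_space
begin

lemma endomorphism_skew:
  assumes "bivector K" "\<And>x y. \<eta> (F x) y = K x y"
  shows "\<eta> (F x) y = - \<eta> x (F y)"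
proof -
  have "\<eta> (F x) y = - K y x" using assms unfolding bivector_def by metis
  then show ?thesis by (simp add: commute[of x "F y"] assms(2)[of y x])
qed

text \<open>The quotient is undefined on null vectors, so compactness is applied to
  \<open>p = Q + \<mu> \<eta>\<close>, with \<open>\<mu>\<close> the infimum of the quotient, on the
  closed causal part of a Euclidean unit sphere. The minimum of \<open>p\<close> there is 0, since a
  positive one would improve the lower bound \<open>\<mu>\<close>; the minimizer is not null because
  \<open>Q\<close> is positive on null vectors.\<close>

lemma causal_min_exists:
  assumes Q: "bilinear (Q :: 'v \<Rightarrow> 'v \<Rightarrow> real)"
    and nonneg: "\<And>x. x \<noteq> 0 \<Longrightarrow> \<eta> x x \<le> 0 \<Longrightarrow> 0 \<le> Q x x"
    and pos: "\<And>x. x \<noteq> 0 \<Longrightarrow> \<eta> x x = 0 \<Longrightarrow> 0 < Q x x"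
  obtains x \<mu> where "0 \<le> \<mu>" "\<eta> x x < 0" "Q x x + \<mu> * \<eta> x x = 0"
    "\<And>y. \<eta> y y < 0 \<Longrightarrow> 0 \<le> Q y y + \<mu> * \<eta> y y"
proof -
  obtain k f where kf: "lorentz_frame k f" by (rule base_frame_exists)
  \<comment> \<open>Reversing the sign in the direction \<open>k\<close> makes the Lorentz form
    Euclidean: \<open>g k k = 1\<close>.\<close>
  define g where "g x y = \<eta> x y + 2 * \<eta> x k * \<eta> y k" for x y
  interpret G: symmetric_form g
  proof
    show "bilinear g"
      by (simp add: g_def bilinear_def linear_iff form_simps algebra_simps)
    show "g x y = g y x" for x y by (simp add: g_def commute[of x y])
  qed
  have form_ge: "- (\<eta> x k)\<^sup>2 \<le> \<eta> x x" for x
    by (subst lorentz_frame_form[OF kf, of x x]) (simp add: power2_eq_square sum_nonneg)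
  have g_ge: "- \<eta> x x \<le> g x x" for x
    using form_ge[of x] by (simp add: g_def power2_eq_square)
  have g_pos: "0 < g x x" if "x \<noteq> 0" for x
  proof (cases "\<eta> x k = 0")
    case True
    then show ?thesis using frame_orthogonal_positive[OF kf, of x] that by (force simp: g_def)
  next
    case False
    then have "0 < (\<eta> x k)\<^sup>2" by simp
    then show ?thesis using form_ge[of x] by (simp add: g_def power2_eq_square)
  qed
  define e where "e i = (case i of 0 \<Rightarrow> k | Suc j \<Rightarrow> f j)" for i
  have N: "N = Suc (N - 1)" using N_ge by simp
  have e: "G.orthonormal N e"
    unfolding G.orthonormal_def
    by (auto simp: e_def g_def lorentz_frameD[OF kf] less_Suc_eq_0_disj split: nat.split)
  have "e ` {..<N} = insert k (f ` {..<N - 1})"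
    by (subst N, subst lessThan_Suc_eq_insert_0) (simp add: e_def image_image)
  then have e_span: "span (e ` {..<N}) = UNIV"
    using kf by (simp add: lorentz_frame_def)
  define R where "R = (\<lambda>x. Q x x / (- \<eta> x x)) ` {x. \<eta> x x < 0}"
  have timelike_nonzero: "x \<noteq> 0" if "\<eta> x x < 0" for x
    using that by (auto simp: form_simps)
  have "k \<in> {x. \<eta> x x < 0}" by (simp add: lorentz_frameD[OF kf])
  then have R_ne: "R \<noteq> {}" by (auto simp: R_def)
  have R_nonneg: "0 \<le> r" if r: "r \<in> R" for r
  proof -
    obtain x where x: "\<eta> x x < 0" "r = Q x x / (- \<eta> x x)"
      using r unfolding R_def by blast
    moreover have "0 \<le> Q x x" using nonneg timelike_nonzero x(1) by fastforce
    ultimately show ?thesis by (simp add: divide_le_0_iff)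
  qed
  define \<mu> where "\<mu> = Inf R"
  have \<mu>0: "0 \<le> \<mu>" unfolding \<mu>_def using R_ne R_nonneg by (rule cInf_greatest)
  have \<mu>_le: "0 \<le> Q y y + \<mu> * \<eta> y y" if "\<eta> y y < 0" for y
  proof -
    have "\<mu> \<le> Q y y / (- \<eta> y y)"
      unfolding \<mu>_def
      by (rule cInf_lower) (use that R_nonneg in \<open>auto simp: R_def intro!: bdd_belowI[of _ 0]\<close>)
    then show ?thesis using that by (simp add: field_simps)
  qed
  define p where "p x y = Q x y + \<mu> * \<eta> x y" for x y
  have p: "bilinear p"
    by (simp add: p_def bilinear_def linear_iff form_simps bilinear_ladd[OF Q] bilinear_radd[OF Q]
        bilinear_lmul[OF Q] bilinear_rmul[OF Q] algebra_simps)
  define S where "S = {x \<in> span (e ` {..<N}). g x x = 1 \<and> \<eta> x x \<le> 0}"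
  have "k \<in> S" by (simp add: S_def e_span g_def lorentz_frameD[OF kf])
  then have S_ne: "S \<noteq> {}" by blast
  obtain x where "x \<in> S" and min: "\<And>y. y \<in> S \<Longrightarrow> p x x \<le> p y y"
    by (rule G.quadratic_attains_min_on_sphere[OF e p bilinear S_def S_ne]) blast
  then have x: "g x x = 1" "\<eta> x x \<le> 0" by (simp_all add: S_def)
  then have x0: "x \<noteq> 0" by (auto simp: G.form_simps)
  have null_pos: "0 < p x x" if "\<eta> x x = 0"
    using pos[OF x0 that] that by (simp add: p_def)
  have "0 \<le> p x x"
    using null_pos \<mu>_le[of x] x(2) by (cases "\<eta> x x = 0") (auto simp: p_def)
  moreover have "\<not> 0 < p x x"
  proof
    assume m: "0 < p x x"
    have "\<mu> + p x x \<le> r" if r: "r \<in> R" for r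
    proof -
      obtain y where y: "\<eta> y y < 0" "r = Q y y / (- \<eta> y y)"
        using r unfolding R_def by blast
      have gy: "0 < g y y" using g_pos timelike_nonzero y(1) by blast
      define s where "s = 1 / sqrt (g y y)"
      have s: "s\<^sup>2 = 1 / g y y" using gy by (simp add: s_def power_divide)
      have "s *\<^sub>R y \<in> S"
        using y(1) gy bilinear_scale_square[OF bilinear, of s y] bilinear_scale_square[OF G.bilinear, of s y]
        by (simp add: S_def e_span s divide_nonpos_pos)
      then have "p x x \<le> p y y / g y y"
        using min bilinear_scale_square[OF p, of s y] by (fastforce simp: s)
      then have "p x x * g y y \<le> p y y" using gy by (simp add: field_simps)
      \<comment> \<open>This passes from the Euclidean normalization of the sphere to the Lorentz
        one of the quotient.\<close>
      moreover have "p x x * (- \<eta> y y) \<le> p x x * g y y"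
        using g_ge[of y] m by (intro mult_left_mono) auto
      ultimately have "(\<mu> + p x x) * (- \<eta> y y) \<le> Q y y"
        unfolding p_def[of y y] by (simp add: algebra_simps)
      moreover have "0 < - \<eta> y y" using y(1) by simp
      ultimately show ?thesis unfolding y(2) by (simp only: pos_le_divide_eq)
    qed
    then have "\<mu> + p x x \<le> \<mu>" unfolding \<mu>_def by (rule cInf_greatest[OF R_ne])
    then show False using m by simp
  qed
  ultimately have px: "p x x = 0" by simp
  then have "\<eta> x x < 0" using null_pos x(2) by fastforce
  then show thesis using that[of \<mu> x] \<mu>0 px \<mu>_le by (simp add: p_def)
qed

text \<open>The hypothesis \<open>no_null\<close> forbids null eigenvectors of \<open>F\<close>,
  phrased through \<open>K\<close>. It gives strict positivity on null vectors, since a null vector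
  orthogonal to a non-zero null \<open>x\<close> is a multiple of \<open>x\<close>.\<close>

lemma timelike_kernel:
  assumes K: "bivector K"
    and no_null: "\<And>l c. l \<noteq> 0 \<Longrightarrow> \<eta> l l = 0 \<Longrightarrow> \<exists>y. K l y \<noteq> c * \<eta> l y"
  obtains k where "\<eta> k k = -1" "\<And>y. K k y = 0"
proof -
  obtain F where F: "linear F" and FK: "\<And>x y. \<eta> (F x) y = K x y"
    using bivector_endomorphism[OF K] by blast
  note skew = endomorphism_skew[OF K FK]
  have nonneg: "0 \<le> \<eta> (F x) (F x)" if "x \<noteq> 0" "\<eta> x x \<le> 0" for x
    using orthogonal_to_causal(1)[OF that skew_self(1)[OF skew]] .
  have pos: "0 < \<eta> (F x) (F x)" if x: "x \<noteq> 0" "\<eta> x x = 0" for x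
  proof -
    have "\<eta> (F x) (F x) \<noteq> 0"
    proof
      assume "\<eta> (F x) (F x) = 0"
      then obtain c where "F x = c *\<^sub>R x"
        using orthogonal_to_causal(2)[OF x(1) _ skew_self(1)[OF skew]] x(2) by auto
      then have "K x y = c * \<eta> x y" for y
        by (simp add: FK[symmetric] form_simps)
      then show False using no_null[OF x] by blast
    qed
    then show ?thesis using nonneg[of x] x by simp
  qed
  obtain x \<mu> where \<mu>: "0 \<le> \<mu>" and x: "\<eta> x x < 0"
    and zero: "\<eta> (F x) (F x) + \<mu> * \<eta> x x = 0"
    and min: "\<And>y. \<eta> y y < 0 \<Longrightarrow> 0 \<le> \<eta> (F y) (F y) + \<mu> * \<eta> y y"
    by (rule causal_min_exists[OF bilinear_image_form[OF F] nonneg pos]) blast+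
  define p where "p u v = \<eta> (F u) (F v) + \<mu> * \<eta> u v" for u v
  interpret p: symmetric_form p
  proof
    show "bilinear p"
      by (simp add: p_def bilinear_def linear_iff form_simps linear_add[OF F] linear_scale[OF F] algebra_simps)
    show "p u v = p v u" for u v
      by (simp add: p_def commute[of u v] commute[of "F u" "F v"])
  qed
  \<comment> \<open>The time-like cone is open, so \<open>min\<close> applies to
    \<open>x + t y\<close> for small \<open>t\<close>; this already puts \<open>x\<close> into the
    radical of \<open>p\<close>.\<close>
  have p0: "p x y = 0" for y
  proof (rule p.semidefinite_null_orthogonal)
    have eq: "\<eta> (x + t *\<^sub>R y) (x + t *\<^sub>R y) = \<eta> x x + 2 * t * \<eta> x y + t\<^sup>2 * \<eta> y y" for t
      by (simp add: form_simps commute[of y x] power2_eq_square algebra_simps)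
    have "((\<lambda>t. \<eta> (x + t *\<^sub>R y) (x + t *\<^sub>R y)) \<longlongrightarrow> \<eta> x x) (nhds 0)"
      unfolding eq by (auto intro!: tendsto_eq_intros filterlim_ident)
    then have "\<forall>\<^sub>F t in nhds 0. \<eta> (x + t *\<^sub>R y) (x + t *\<^sub>R y) < 0"
      using x by (rule order_tendstoD(2))
    then show "\<forall>\<^sub>F t in nhds 0. 0 \<le> p (x + t *\<^sub>R y) (x + t *\<^sub>R y)"
      by eventually_elim (simp add: p_def min)
    show "p x x = 0" using zero by (simp add: p_def)
  qed
  have Fx: "F x = 0"
  proof (rule ccontr)
    assume "F x \<noteq> 0"
    then have "0 < \<eta> (F x) (F x)"
      using orthogonal_to_timelike[OF x skew_self(1)[OF skew]] by blast
    then have \<mu>_pos: "0 < \<mu>" using zero x \<mu> by (cases "\<mu> = 0") auto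
    \<comment> \<open>Since \<open>(F - sqrt \<mu>) (F + sqrt \<mu>) x = 0\<close>, this is an
      eigenvector for \<open>sqrt \<mu>\<close>; it is null because \<open>F x\<close> is orthogonal
      to \<open>x\<close> and the two squares cancel.\<close>
    define v where "v = F x + sqrt \<mu> *\<^sub>R x"
    have ss: "sqrt \<mu> * sqrt \<mu> = \<mu>" using \<mu> by simp
    have "F (F x) - \<mu> *\<^sub>R x = 0"
    proof (rule nondegenerate)
      show "\<eta> (F (F x) - \<mu> *\<^sub>R x) y = 0" for y
        using p0[of y] by (simp add: p_def form_simps skew)
    qed
    then have Fv: "F v = sqrt \<mu> *\<^sub>R v"
      by (simp add: v_def linear_add[OF F] linear_scale[OF F] scaleR_add_right ss \<mu>)
    have "\<eta> v v = \<eta> (F x) (F x) + \<mu> * \<eta> x x"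
      by (simp add: v_def form_simps skew_self[OF skew] ss \<mu> mult.assoc[symmetric])
    then have "\<eta> v v = 0" using zero by simp
    moreover have "\<eta> v x \<noteq> 0"
      using x \<mu>_pos by (simp add: v_def form_simps skew_self[OF skew])
    then have "v \<noteq> 0" by (auto simp: form_simps)
    ultimately obtain y where "K v y \<noteq> sqrt \<mu> * \<eta> v y" using no_null by blast
    then show False by (simp add: FK[symmetric] Fv form_simps)
  qed
  define k where "k = (1 / sqrt (- \<eta> x x)) *\<^sub>R x"
  have "K k y = 0" for y
    by (simp add: FK[symmetric] k_def linear_scale[OF F] Fx form_simps)
  moreover have "\<eta> k k = -1"
    using x by (simp add: k_def form_simps)
  ultimately show thesis by (rule that[rotated])
qed

text \<open>The complement of \<open>k\<close> is invariant and of even dimension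
  \<open>2 * r\<close>, so the planes fill it without a leftover axis. Some \<open>c p\<close> may
  vanish.\<close>

lemma bivector_normal_form:
  assumes K: "bivector K" and k: "\<eta> k k = -1" "\<And>y. K k y = 0" and r: "N = 2 * r + 1"
  obtains f c where "lorentz_frame k f"
    "\<And>x y. K x y = (\<Sum>p<r. c p * (\<eta> x (f (2 * p)) * \<eta> y (f (2 * p + 1)) - \<eta> x (f (2 * p + 1)) * \<eta> y (f (2 * p))))"
proof -
  obtain F where F: "linear F" and FK: "\<And>x y. \<eta> (F x) y = K x y"
    using bivector_endomorphism[OF K] by blast
  note skew = endomorphism_skew[OF K FK]
  have Fk: "F k = 0" by (rule nondegenerate) (simp add: FK k)
  define W where "W = {x. \<eta> k x = 0}"
  have W: "subspace W" unfolding W_def by (rule subspace_orthogonal)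
  have pos: "0 < \<eta> x x" if "x \<in> W" "x \<noteq> 0" for x
    using orthogonal_to_timelike[of k x] k that by (simp add: W_def)
  have inv: "F x \<in> W" if "x \<in> W" for x
    using skew[of k x] by (simp add: W_def Fk form_simps)
  obtain B where B: "finite B" "span B = (UNIV :: 'v set)" by (rule finite_basis)
  obtain e where e: "lorentz_frame k e"
    using lorentz_frame_extension[OF k(1), of 0 "\<lambda>_. 0"] by (auto simp: orthonormal_def)
  have "span (e ` {..<N - 1}) = W"
  proof
    show "span (e ` {..<N - 1}) \<subseteq> W"
      using W lorentz_frameD(2)[OF e] by (intro span_minimal) (auto simp: W_def)
    show "W \<subseteq> span (e ` {..<N - 1})"
    proof
      fix x assume x: "x \<in> W"
      have "(\<Sum>i<N - 1. \<eta> x (e i) *\<^sub>R e i) = x"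
        by (rule trans[OF _ lorentz_frame_expansion[OF e, symmetric]])
          (use x commute[of x k] in \<open>simp add: W_def\<close>)
      moreover have "(\<Sum>i<N - 1. \<eta> x (e i) *\<^sub>R e i) \<in> span (e ` {..<N - 1})"
        by (intro span_sum span_scale span_base) auto
      ultimately show "x \<in> span (e ` {..<N - 1})" by simp
    qed
  qed
  moreover have eo: "orthonormal (N - 1) e" using e by (simp add: lorentz_frame_def)
  ultimately have "dim W = 2 * r"
    using dim_span_eq_card_independent[OF orthonormal_independent(2)[OF eo]]
      card_image[OF orthonormal_independent(1)[OF eo]] r by simp
  then obtain f0 c where f0: "f0 ` {..<2 * r} \<subseteq> W" "orthonormal (2 * r) f0"
    and Ff0: "\<And>p. p < r \<Longrightarrow> F (f0 (2 * p)) = c p *\<^sub>R f0 (2 * p + 1)"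
      "\<And>p. p < r \<Longrightarrow> F (f0 (2 * p + 1)) = (- c p) *\<^sub>R f0 (2 * p)"
    using skew_normal_form[OF B F skew W pos inv] by blast
  have "\<eta> k (f0 i) = 0" if "i < 2 * r" for i
    using f0(1) that by (auto simp: W_def)
  \<comment> \<open>No vector is added, as \<open>2 * r = N - 1\<close>; the extension supplies the
    spanning condition.\<close>
  then obtain f where f: "lorentz_frame k f" and ff0: "\<And>i. i < 2 * r \<Longrightarrow> f i = f0 i"
    using lorentz_frame_extension[OF k(1) f0(2)] by blast
  have Ff: "F (f (2 * p)) = c p *\<^sub>R f (2 * p + 1)" "F (f (2 * p + 1)) = (- c p) *\<^sub>R f (2 * p)"
    if "p < r" for p
    using Ff0[OF that] that by (simp_all add: ff0)
  have Nr: "N - 1 = 2 * r" using r by simp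
  have "K x y = (\<Sum>p<r. c p * (\<eta> x (f (2 * p)) * \<eta> y (f (2 * p + 1)) - \<eta> x (f (2 * p + 1)) * \<eta> y (f (2 * p))))" for x y
  proof -
    have "F x = F ((- \<eta> x k) *\<^sub>R k + (\<Sum>i<2 * r. \<eta> x (f i) *\<^sub>R f i))"
      by (rule arg_cong[OF lorentz_frame_expansion[OF f, unfolded Nr]])
    also have "\<dots> = (\<Sum>i<2 * r. \<eta> x (f i) *\<^sub>R F (f i))"
      by (simp only: linear_add[OF F] linear_sum[OF F] linear_scale[OF F] Fk) simp
    finally have "K x y = (\<Sum>i<2 * r. \<eta> x (f i) * \<eta> (F (f i)) y)"
      by (simp add: FK[symmetric, of x] form_sum_left form_simps)
    also have "\<dots> = (\<Sum>p<r. \<eta> x (f (2 * p)) * \<eta> (F (f (2 * p))) y + \<eta> x (f (2 * p + 1)) * \<eta> (F (f (2 * p + 1))) y)"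
      by (rule sum_pairs)
    also have "\<dots> = (\<Sum>p<r. c p * (\<eta> x (f (2 * p)) * \<eta> y (f (2 * p + 1)) - \<eta> x (f (2 * p + 1)) * \<eta> y (f (2 * p))))"
    proof (rule sum.cong)
      fix p assume "p \<in> {..<r}"
      then have "p < r" by simp
      from Ff[OF this] show "\<eta> x (f (2 * p)) * \<eta> (F (f (2 * p))) y + \<eta> x (f (2 * p + 1)) * \<eta> (F (f (2 * p + 1))) y =
          c p * (\<eta> x (f (2 * p)) * \<eta> y (f (2 * p + 1)) - \<eta> x (f (2 * p + 1)) * \<eta> y (f (2 * p)))"
        by (simp only: form_simps commute[of y] real_scaleR_def) (simp add: algebra_simps)
    qed simp
    finally show ?thesis .
  qed
  then show thesis by (rule that[OF f])
qed

end

section \<open>Null frames\<close>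

text \<open>The Gram matrix exhibits a dual family, hence independence, and \<open>N\<close>
  independent vectors in a space spanned by \<open>N\<close> vectors span it.\<close>

lemma (in vector_space) null_frameI:
  fixes g :: "'b \<Rightarrow> 'b \<Rightarrow> 'a"
  assumes B: "finite B" "span B = UNIV" "card B = N" and "2 \<le> N"
    and add: "\<And>x y z. g (x + y) z = g x z + g y z"
    and scale: "\<And>c x z. g (scale c x) z = c * g x z"
    and gram: "\<And>i j. i < N \<Longrightarrow> j < N \<Longrightarrow>
      g (m i) (m j) = (if {i, j} = {0, 1} \<or> (i = j \<and> 2 \<le> i) then 1 else 0)"
  shows "null_frame scale N g m"
proof -
  \<comment> \<open>The first two vectors are null and pair with each other, so their duals are
    interchanged.\<close>
  define m' where "m' i = (if i = 0 then m 1 else if i = 1 then m 0 else m i)" for i :: nat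
  have "g (m i) (m' j) = (if i = j then 1 else 0)" if "i < N" "j < N" for i j
    using gram[of i 0] gram[of i 1] gram[OF that] that \<open>2 \<le> N\<close>
    by (auto simp: m'_def doubleton_eq_iff)
  note m = dual_family_independent[of g N m m', OF add scale this]
  have card: "card (m ` {..<N}) = N" using m(1) by (simp add: card_image)
  have "x \<in> span (m ` {..<N})" for x
  proof (rule ccontr)
    assume x: "x \<notin> span (m ` {..<N})"
    then have "independent (insert x (m ` {..<N}))" using m(2) by (rule independent_insertI)
    then have "card (insert x (m ` {..<N})) \<le> N"
      using independent_span_bound[OF B(1)] B(2,3) by auto
    moreover have "x \<notin> m ` {..<N}" using span_base x by (rule contrapos_nn[rotated])
    ultimately show False using card_insert_disjoint[of "m ` {..<N}" x] card by simp
  qed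
  then show ?thesis
    using m gram by (auto simp: null_frame_def basis_family_def)
qed

lemma complexify_form_simps:
  assumes "bilinear B"
  shows "complexify_form B (x + y) z = complexify_form B x z + complexify_form B y z"
    and "complexify_form B z (x + y) = complexify_form B z x + complexify_form B z y"
    and "complexify_form B (complexify_scale c x) z = c * complexify_form B x z"
    and "complexify_form B z (complexify_scale c x) = c * complexify_form B z x"
    and "complexify_form B 0 z = 0" and "complexify_form B z 0 = 0"
  by (simp_all add: complexify_form_def complexify_scale_def complex_eq_iff bilinear_ladd[OF assms]
      bilinear_radd[OF assms] bilinear_lsub[OF assms] bilinear_rsub[OF assms] bilinear_lmul[OF assms]
      bilinear_rmul[OF assms] bilinear_lzero[OF assms] bilinear_rzero[OF assms] algebra_simps)

lemma span_complexification:
  assumes "span B = (UNIV :: 'v::real_vector set)"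
  shows "complexification.span ((\<lambda>x. (x, 0)) ` B) = (UNIV :: ('v \<times> 'v) set)"
proof -
  let ?S = "complexification.span ((\<lambda>x. (x, 0 :: 'v)) ` B)"
  have S: "complexification.subspace ?S" by (rule complexification.subspace_span)
  have sc: "(r *\<^sub>R x, 0) \<in> ?S" if "(x, 0) \<in> ?S" for r x
    using complexification.subspace_scale[OF S that, of "of_real r"] by (simp add: complexify_scale_def)
  have add: "(x + y, 0) \<in> ?S" if "(x, 0) \<in> ?S" "(y, 0) \<in> ?S" for x y
    using complexification.subspace_add[OF S that] by simp
  have "subspace {x. (x, 0) \<in> ?S}"
    using complexification.subspace_0[OF S] sc add by (intro subspaceI) (auto simp: zero_prod_def)
  moreover have "B \<subseteq> {x. (x, 0) \<in> ?S}" by (auto intro: complexification.span_base)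
  ultimately have "span B \<subseteq> {x. (x, 0) \<in> ?S}" by (rule span_minimal[rotated])
  then have re: "(x, 0) \<in> ?S" for x using assms by auto
  have "(x, y) \<in> ?S" for x y
    using complexification.subspace_add[OF S re[of x] complexification.subspace_scale[OF S re[of y], of \<i>]]
    by (simp add: complexify_scale_def)
  then show ?thesis by auto
qed

section \<open>Real null frames, existence of type 0 and the canonical form\<close>

context lorentz_space
begin

text \<open>The factor \<open>1 / sqrt 2\<close> gives the two null vectors product 1. The map
  \<open>\<sigma>\<close> orders the remaining space-like vectors: a shift suffices to complete a
  given null vector, while the canonical form wants \<open>f 1\<close> in the last place.\<close>

definition split_frame :: "'v \<Rightarrow> (nat \<Rightarrow> 'v) \<Rightarrow> (nat \<Rightarrow> nat) \<Rightarrow> nat \<Rightarrow> 'v" where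
  "split_frame k f \<sigma> i =
     (if i = 0 then (1 / sqrt 2) *\<^sub>R (f 0 + k)
      else if i = 1 then (1 / sqrt 2) *\<^sub>R (f 0 - k) else f (\<sigma> i))"

lemma real_null_frame_split_frame:
  assumes kf: "lorentz_frame k f" and \<sigma>: "inj_on \<sigma> {2..<N}" "\<sigma> ` {2..<N} \<subseteq> {1..<N - 1}"
  shows "real_null_frame N \<eta> (split_frame k f \<sigma>)"
proof -
  obtain B where B: "finite B" "span B = (UNIV :: 'v set)" "card B = N" by (rule finite_basis)
  have N: "0 < N - 1" "2 \<le> N" using N_ge by auto
  note [simp] = lorentz_frameD[OF kf]
  have \<sigma>_lt: "\<sigma> i < N - 1" "\<sigma> i \<noteq> 0" if "2 \<le> i" "i < N" for i
    using subsetD[OF \<sigma>(2) imageI[of i]] that by auto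
  have \<sigma>_eq: "\<sigma> i = \<sigma> j \<longleftrightarrow> i = j" if "2 \<le> i" "i < N" "2 \<le> j" "j < N" for i j
    using inj_on_eq_iff[OF \<sigma>(1)] that by simp
  have cases: "i = 0 \<or> i = 1 \<or> 2 \<le> i" for i :: nat by linarith
  have gram: "\<eta> (split_frame k f \<sigma> i) (split_frame k f \<sigma> j) =
      (if {i, j} = {0, 1} \<or> (i = j \<and> 2 \<le> i) then 1 else 0)" if "i < N" "j < N" for i j
    using cases[of i] cases[of j] N that \<sigma>_lt[of i] \<sigma>_lt[of j] \<sigma>_eq[of i j]
    by (elim disjE) (simp_all add: split_frame_def form_simps doubleton_eq_iff)
  show ?thesis
    by (rule real_vector.null_frameI[OF B N(2)]) (simp_all only: form_simps real_scaleR_def gram)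
qed

text \<open>Every non-zero null vector is the first member of some real null frame. For an
  eigenvector \<open>l\<close> the components \<open>K l (m i)\<close> with \<open>2 \<le> i\<close>
  are multiples of \<open>\<eta> l (m i) = 0\<close>, against type 0.\<close>

lemma type_0_no_null_eigenvector:
  assumes K: "real_alignment_type_0 N \<eta> K" and l: "l \<noteq> 0" "\<eta> l l = 0"
  shows "\<exists>y. K l y \<noteq> c * \<eta> l y"
proof (rule ccontr)
  assume "\<not> ?thesis"
  then have eig: "K l y = c * \<eta> l y" for y by blast
  obtain k0 f0 where k0: "lorentz_frame k0 f0" by (rule base_frame_exists)
  have lk0: "\<eta> l k0 \<noteq> 0" using frame_orthogonal_positive(2)[OF k0] l by blast
  \<comment> \<open>\<open>a\<close> normalizes \<open>\<eta> l n = 1\<close>; the coefficient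
    \<open>a\<^sup>2 / 2\<close> of \<open>l\<close> then makes \<open>n\<close> null, as
    \<open>\<eta> k0 k0 = -1\<close>.\<close>
  define a where "a = 1 / \<eta> l k0"
  define n where "n = a *\<^sub>R k0 + (a\<^sup>2 / 2) *\<^sub>R l"
  have a: "a * \<eta> l k0 = 1" using lk0 by (simp add: a_def)
  have ln: "\<eta> l n = 1" using a by (simp add: n_def form_simps l)
  have nl: "\<eta> n l = 1" using ln by (subst commute)
  have "\<eta> n n = a * \<eta> k0 n + (a\<^sup>2 / 2) * \<eta> l n"
    by (subst (1) n_def) (simp add: form_simps)
  also have "\<eta> k0 n = - a + (a\<^sup>2 / 2) * \<eta> l k0"
    by (simp add: n_def form_simps lorentz_frameD[OF k0] commute[of k0 l])
  also have "a * (- a + (a\<^sup>2 / 2) * \<eta> l k0) = - a\<^sup>2 + a\<^sup>2 / 2 * (a * \<eta> l k0)"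
    by (simp add: power2_eq_square algebra_simps)
  finally have nn: "\<eta> n n = 0" by (simp add: a ln)
  \<comment> \<open>Chosen so that \<open>split_frame\<close> recovers \<open>l\<close> as
    \<open>(s + k) / sqrt 2\<close> and \<open>n\<close> as \<open>(s - k) / sqrt 2\<close>.\<close>
  define k where "k = (1 / sqrt 2) *\<^sub>R (l - n)"
  define s where "s = (1 / sqrt 2) *\<^sub>R (l + n)"
  have kk: "\<eta> k k = -1" and ss: "orthonormal 1 (\<lambda>_. s)" and ks: "\<eta> k s = 0"
    by (simp_all add: k_def s_def form_simps ln nl nn l orthonormal_def)
  obtain f where f: "lorentz_frame k f" and f0: "f 0 = s"
    by (rule lorentz_frame_extension[OF kk ss]) (use ks in auto)
  define m where "m = split_frame k f (\<lambda>i. i - 1)"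
  have frame: "real_null_frame N \<eta> m"
    unfolding m_def by (rule real_null_frame_split_frame[OF f]) (auto simp: inj_on_def)
  have "s + k = sqrt 2 *\<^sub>R l"
    by (simp add: s_def k_def scaleR_add_right scaleR_diff_right scaleR_add_left[symmetric] real_divide_square_eq)
       (simp add: field_simps)
  then have "m 0 = l" by (simp add: m_def split_frame_def f0)
  moreover have "\<eta> (m 0) (m i) = 0" if "i \<in> {2..<N}" for i
    using frame that by (simp add: null_frame_def doubleton_eq_iff)
  ultimately have "K (m 0) (m i) = 0" if "i \<in> {2..<N}" for i
    using that by (simp add: eig)
  then show False using K frame by (auto simp: alignment_type_0_def)
qed

text \<open>The first argument stays arbitrary so that the complexified version follows from real
  and imaginary parts.\<close>

lemma normal_form_right:
  assumes f: "lorentz_frame k f" and r: "N = 2 * r + 1"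
    and K: "\<And>x y. K x y = (\<Sum>p<r. c p * (\<eta> x (f (2 * p)) * \<eta> y (f (2 * p + 1)) - \<eta> x (f (2 * p + 1)) * \<eta> y (f (2 * p))))"
  shows "K x k = 0"
    and "q < r \<Longrightarrow> K x (f (2 * q)) = - c q * \<eta> x (f (2 * q + 1))"
    and "q < r \<Longrightarrow> K x (f (2 * q + 1)) = c q * \<eta> x (f (2 * q))"
proof -
  note [simp] = lorentz_frameD[OF f]
  show "K x k = 0" unfolding K by (rule sum.neutral) (use r in simp)
  assume q: "q < r"
  have "K x (f (2 * q)) = (\<Sum>p<r. if p = q then - c q * \<eta> x (f (2 * q + 1)) else 0)"
    unfolding K
  proof (rule sum.cong)
    fix p assume "p \<in> {..<r}"
    then show "c p * (\<eta> x (f (2 * p)) * \<eta> (f (2 * q)) (f (2 * p + 1)) - \<eta> x (f (2 * p + 1)) * \<eta> (f (2 * q)) (f (2 * p))) =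
        (if p = q then - c q * \<eta> x (f (2 * q + 1)) else 0)"
      using q r double_not_eq_Suc_double[of q p] by simp
  qed simp
  then show "K x (f (2 * q)) = - c q * \<eta> x (f (2 * q + 1))" using q by simp
  have "K x (f (2 * q + 1)) = (\<Sum>p<r. if p = q then c q * \<eta> x (f (2 * q)) else 0)"
    unfolding K
  proof (rule sum.cong)
    fix p assume "p \<in> {..<r}"
    then show "c p * (\<eta> x (f (2 * p)) * \<eta> (f (2 * q + 1)) (f (2 * p + 1)) - \<eta> x (f (2 * p + 1)) * \<eta> (f (2 * q + 1)) (f (2 * p))) =
        (if p = q then c q * \<eta> x (f (2 * q)) else 0)"
      using q r Suc_double_not_eq_double[of q p] by simp
  qed simp
  then show "K x (f (2 * q + 1)) = c q * \<eta> x (f (2 * q))" using q by simp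
qed

text \<open>All planes get coefficient 1, so the kernel of \<open>K\<close> is the line of
  \<open>k\<close>. A null frame violating type 0 would make \<open>m 0\<close> an eigenvector;
  evaluation at \<open>k\<close> forces the eigenvalue 0, and then \<open>m 0\<close> is orthogonal
  to every \<open>f i\<close> and cannot be null.\<close>

lemma type_0_exists:
  assumes r: "N = 2 * r + 1"
  shows "\<exists>K. bivector K \<and> real_alignment_type_0 N \<eta> K"
proof -
  obtain k f where f: "lorentz_frame k f" by (rule base_frame_exists)
  define K where "K x y = (\<Sum>p<r. 1 * (\<eta> x (f (2 * p)) * \<eta> y (f (2 * p + 1)) - \<eta> x (f (2 * p + 1)) * \<eta> y (f (2 * p))))" for x y
  note right = normal_form_right[OF f r, of K "\<lambda>_. 1", OF K_def]
  have skew: "K x y = - K y x" for x y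
    unfolding K_def sum_negf[symmetric] by (intro sum.cong) simp_all
  have "linear (K x)" for x
    by (rule linearI) (simp_all add: K_def form_simps sum.distrib[symmetric] sum_distrib_left algebra_simps)
  moreover have "linear (\<lambda>x. K x y)" for y
    by (rule linearI) (simp_all add: K_def form_simps sum.distrib[symmetric] sum_distrib_left algebra_simps)
  ultimately have K: "bivector K"
    unfolding bivector_def bilinear_def using skew by blast
  have K_lin: "bilinear K" using K by (simp add: bivector_def)
  have r0: "0 < r" using r N_ge by simp
  have "K (f 0) (f 1) = 1"
    using right(3)[OF r0, of "f 0"] r r0 lorentz_frameD(4)[OF f, of 0 0] by simp
  then have "K \<noteq> (\<lambda>x y. 0)" by auto
  moreover have "\<exists>i\<in>{2..<N}. K (m 0) (m i) \<noteq> 0" if m: "real_null_frame N \<eta> m" for m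
  proof (rule ccontr)
    assume "\<not> ?thesis"
    then have zero: "K (m 0) (m i) = 0" if "2 \<le> i" "i < N" for i using that by auto
    have gram: "\<eta> (m 0) (m i) = (if i = 1 then 1 else 0)" if "i < N" for i
      using m that N_ge by (auto simp: null_frame_def doubleton_eq_iff)
    \<comment> \<open>The one component of \<open>K (m 0)\<close> left over; it becomes the
      eigenvalue.\<close>
    define a where "a = K (m 0) (m 1)"
    have "subspace {y. K (m 0) y = a * \<eta> (m 0) y}"
      by (rule subspaceI)
        (simp_all add: form_simps bilinear_radd[OF K_lin] bilinear_rmul[OF K_lin] bilinear_rzero[OF K_lin] algebra_simps)
    moreover have "m ` {..<N} \<subseteq> {y. K (m 0) y = a * \<eta> (m 0) y}"
    proof
      fix y assume "y \<in> m ` {..<N}"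
      then obtain i where i: "i < N" "y = m i" by auto
      consider "i = 0" | "i = 1" | "2 \<le> i" by linarith
      then show "y \<in> {y. K (m 0) y = a * \<eta> (m 0) y}"
        using skew[of "m 0" "m 0"] gram[OF i(1)] zero[of i] i by cases (auto simp: a_def)
    qed
    ultimately have "span (m ` {..<N}) \<subseteq> {y. K (m 0) y = a * \<eta> (m 0) y}"
      by (rule span_minimal[rotated])
    then have eig: "K (m 0) y = a * \<eta> (m 0) y" for y
      using m by (auto simp: null_frame_def basis_family_def span_raw_def)
    have m0: "\<eta> (m 0) (m 0) = 0" "m 0 \<noteq> 0"
      using gram[of 0] gram[of 1] N_ge by (auto simp: form_simps)
    then have mk: "\<eta> (m 0) k \<noteq> 0" using frame_orthogonal_positive(2)[OF f] by blast
    then have "a = 0" using right(1)[of "m 0"] eig[of k] by simp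
    then have K0: "K (m 0) y = 0" for y using eig by simp
    have pairs: "\<eta> (m 0) (f (2 * q)) = 0" "\<eta> (m 0) (f (2 * q + 1)) = 0" if "q < r" for q
      using right(2,3)[OF that, of "m 0"] K0 by simp_all
    have "\<eta> (m 0) (m 0) = - (\<eta> (m 0) k * \<eta> (m 0) k) + (\<Sum>i<2 * r. \<eta> (m 0) (f i) * \<eta> (m 0) (f i))"
      using lorentz_frame_form[OF f, of "m 0" "m 0"] r by simp
    also have "\<dots> = - (\<eta> (m 0) k * \<eta> (m 0) k)"
      unfolding sum_pairs by (simp add: pairs[simplified])
    finally show False using m0 mk by simp
  qed
  ultimately show ?thesis using K by (auto simp: alignment_type_0_def)
qed

lemma canonical_form:
  assumes f: "lorentz_frame k f" and r: "N = 2 * r + 1"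
    and K: "\<And>x y. K x y = (\<Sum>p<r. c p * (\<eta> x (f (2 * p)) * \<eta> y (f (2 * p + 1)) - \<eta> x (f (2 * p + 1)) * \<eta> y (f (2 * p))))"
  shows "\<exists>m c. real_null_frame N \<eta> m \<and>
    (\<forall>x y. K x y =
       c 0 * (lowered_wedge \<eta> (m 1) (m (N - 1)) x y + lowered_wedge \<eta> (m 0) (m (N - 1)) x y)
       + (\<Sum>p = 1..(N - 3) div 2. c p * lowered_wedge \<eta> (m (2 * p)) (m (2 * p + 1)) x y))"
proof -
  \<comment> \<open>\<open>f 1\<close>, the partner of \<open>f 0\<close>, takes the last place;
    other indices are kept, so plane \<open>p\<close> sits at positions \<open>2 * p\<close> and
    \<open>2 * p + 1\<close>.\<close>
  define \<sigma> where "\<sigma> i = (if i = N - 1 then 1 else i)" for i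
  define m where "m = split_frame k f \<sigma>"
  \<comment> \<open>The factor 2 undoes the 1/2 in \<open>lowered_wedge\<close>; in plane 0 the sum
    \<open>m 0 + m 1\<close>, which is \<open>sqrt 2\<close> times \<open>f 0\<close>, already
    contributes \<open>sqrt 2\<close>.\<close>
  define b where "b p = (if p = 0 then sqrt 2 * c 0 else 2 * c p)" for p
  obtain s where s: "r = Suc s" using r N_ge by (cases r) auto
  have [simp]: "N - Suc 0 \<noteq> Suc 0" "N - Suc 0 \<noteq> 0" using N_ge by auto
  have Ns: "(N - 3) div 2 = s" using r s by simp
  have frame: "real_null_frame N \<eta> m"
    unfolding m_def using N_ge
    by (intro real_null_frame_split_frame[OF f]) (auto simp: inj_on_def \<sigma>_def split: if_splits)
  have m01: "m 0 = (1 / sqrt 2) *\<^sub>R (f 0 + k)" "m 1 = (1 / sqrt 2) *\<^sub>R (f 0 - k)" "m (N - 1) = f 1"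
    using r s N_ge by (simp_all add: m_def split_frame_def \<sigma>_def)
  have mp: "m (2 * p) = f (2 * p)" "m (2 * p + 1) = f (2 * p + 1)" if "p \<in> {1..s}" for p
    using that r s by (auto simp: m_def split_frame_def \<sigma>_def)
  have "K x y = b 0 * (lowered_wedge \<eta> (m 1) (m (N - 1)) x y + lowered_wedge \<eta> (m 0) (m (N - 1)) x y)
       + (\<Sum>p = 1..s. b p * lowered_wedge \<eta> (m (2 * p)) (m (2 * p + 1)) x y)" for x y
  proof -
    let ?t = "\<lambda>p. c p * (\<eta> x (f (2 * p)) * \<eta> y (f (2 * p + 1)) - \<eta> x (f (2 * p + 1)) * \<eta> y (f (2 * p)))"
    have "K x y = ?t 0 + (\<Sum>p = 1..s. ?t p)"
      unfolding K s One_nat_def sum.atLeast1_atMost_eq by (rule sum.lessThan_Suc_shift)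
    also have "(\<Sum>p = 1..s. ?t p) = (\<Sum>p = 1..s. b p * lowered_wedge \<eta> (m (2 * p)) (m (2 * p + 1)) x y)"
      by (rule sum.cong) (auto simp: mp[simplified] b_def lowered_wedge_def commute[of x] commute[of y])
    also have "?t 0 = b 0 * (lowered_wedge \<eta> (m 1) (m (N - 1)) x y + lowered_wedge \<eta> (m 0) (m (N - 1)) x y)"
    proof -
      have "m 1 + m 0 = (2 / sqrt 2) *\<^sub>R f 0"
        unfolding m01 scaleR_add_right[symmetric] by (simp add: scaleR_2[symmetric])
      then have sum: "\<eta> (m 1) z + \<eta> (m 0) z = sqrt 2 * \<eta> (f 0) z" for z
        by (simp add: bilinear_ladd[OF bilinear, symmetric] real_div_sqrt form_simps)
      have "lowered_wedge \<eta> (m 1) (m (N - 1)) x y + lowered_wedge \<eta> (m 0) (m (N - 1)) x y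
          = ((\<eta> (m 1) x + \<eta> (m 0) x) * \<eta> (f 1) y - (\<eta> (m 1) y + \<eta> (m 0) y) * \<eta> (f 1) x) / 2"
        unfolding lowered_wedge_def m01(3) by (simp add: field_simps)
      then have wedge: "lowered_wedge \<eta> (m 1) (m (N - 1)) x y + lowered_wedge \<eta> (m 0) (m (N - 1)) x y
          = sqrt 2 * ((\<eta> (f 0) x * \<eta> (f 1) y - \<eta> (f 0) y * \<eta> (f 1) x) / 2)"
        unfolding sum by (simp add: algebra_simps)
      have "b 0 * sqrt 2 = 2 * c 0" by (simp add: b_def)
      then show ?thesis
        unfolding wedge mult.assoc[symmetric] by (simp add: commute[of x] commute[of y] algebra_simps)
    qed
    finally show ?thesis .
  qed
  then show ?thesis unfolding Ns using frame by blast
qed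

end

section \<open>Complex alignment type\<close>

context lorentz_space
begin

lemma complex_null_frameI:
  assumes "\<And>i j. i < N \<Longrightarrow> j < N \<Longrightarrow> complexify_form \<eta> (m i) (m j) =
    (if {i, j} = {0, 1} \<or> (i = j \<and> 2 \<le> i) then 1 else 0)"
  shows "complex_null_frame N \<eta> m"
proof -
  obtain B where B: "finite B" "span B = (UNIV :: 'v set)" "card B = N" by (rule finite_basis)
  show ?thesis
  proof (rule complexification.null_frameI)
    show "finite ((\<lambda>x. (x, 0 :: 'v)) ` B)" using B(1) by simp
    show "complexification.span ((\<lambda>x. (x, 0)) ` B) = UNIV" by (rule span_complexification[OF B(2)])
    show "card ((\<lambda>x. (x, 0 :: 'v)) ` B) = N" using B(3) by (simp add: card_image inj_on_def)
    show "2 \<le> N" using N_ge by simp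
  qed (simp_all only: complexify_form_simps[OF bilinear] assms)
qed

lemma complexify_form_normal_form_right:
  assumes f: "lorentz_frame k f" and r: "N = 2 * r + 1" and bil: "bilinear K"
    and K: "\<And>x y. K x y = (\<Sum>p<r. c p * (\<eta> x (f (2 * p)) * \<eta> y (f (2 * p + 1)) - \<eta> x (f (2 * p + 1)) * \<eta> y (f (2 * p))))"
    and q: "q < r"
  shows "complexify_form K x (f (2 * q + 1), 0) = complex_of_real (c q) * complexify_form \<eta> x (f (2 * q), 0)"
    and "complexify_form K x (f (2 * q), 0) = - complex_of_real (c q) * complexify_form \<eta> x (f (2 * q + 1), 0)"
  by (simp_all only: complexify_form_def fst_conv snd_conv normal_form_right(2,3)[OF f r K q]
      bilinear_rzero[OF bil] bilinear_rzero[OF bilinear] complex_eq_iff) simp_all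

text \<open>Relative to a frame exhibiting type 2, \<open>K\<close> is the wedge of the null covector of \<open>m 0\<close> with
  \<open>K (m 1)\<close>.\<close>

lemma type_2_wedge:
  assumes bil: "bilinear K" and skew: "\<And>x y. K x y = - K y x"
    and m: "complex_null_frame N \<eta> m"
    and K0: "\<And>i. i \<in> {2..<N} \<Longrightarrow> complexify_form K (m 0) (m i) = 0" "complexify_form K (m 0) (m 1) = 0"
    and Kij: "\<And>i j. i \<in> {2..<N} \<Longrightarrow> j \<in> {2..<N} \<Longrightarrow> complexify_form K (m i) (m j) = 0"
  shows "complexify_form K x y = complexify_form \<eta> (m 0) x * complexify_form K (m 1) y
    - complexify_form \<eta> (m 0) y * complexify_form K (m 1) x"
proof -
  define G where "G = complexify_form \<eta>"
  define C where "C = complexify_form K"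
  note G_simps = complexify_form_simps[OF bilinear, folded G_def]
  note C_simps = complexify_form_simps[OF bil, folded C_def]
  have C_skew: "C u v = - C v u" for u v
    using skew[of "fst u" "fst v"] skew[of "fst u" "snd v"] skew[of "snd u" "fst v"] skew[of "snd u" "snd v"]
    by (simp add: C_def complexify_form_def complex_eq_iff)
  have C_self: "C u u = 0" for u using C_skew[of u u] by simp
  have G0: "G (m 0) (m i) = (if i = 1 then 1 else 0)" if "i < N" for i
    using m that N_ge by (auto simp: null_frame_def doubleton_eq_iff G_def)
  \<comment> \<open>The defect of the claim is bilinear, so its vanishing on pairs of frame vectors
    suffices.\<close>
  define D where "D u v = C u v - (G (m 0) u * C (m 1) v - G (m 0) v * C (m 1) u)" for u v
  have "D (u + u') v = D u v + D u' v" "D (complexify_scale c u) v = c * D u v" "D 0 v = 0"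
    "D v (u + u') = D v u + D v u'" "D v (complexify_scale c u) = c * D v u" "D v 0 = 0" for u u' v c
    by (simp_all add: D_def G_simps C_simps algebra_simps)
  note D_simps = this
  have sub1: "complexification.subspace {u. D u v = 0}" for v
    by (rule complexification.subspaceI) (simp_all add: D_simps)
  have sub2: "complexification.subspace {v. D u v = 0}" for u
    by (rule complexification.subspaceI) (simp_all add: D_simps)
  have span: "complexification.span (m ` {..<N}) = UNIV"
    using m by (simp add: null_frame_def basis_family_def)
  have cases: "i = 0 \<or> i = 1 \<or> i \<in> {2..<N}" if "i < N" for i using that by auto
  have C0: "C (m 0) (m i) = 0" "C (m i) (m 0) = 0" if "i < N" for i
    using cases[OF that] K0 C_self C_skew[of "m i" "m 0"] by (auto simp: C_def)
  have D: "D (m i) (m j) = 0" if "i < N" "j < N" for i j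
  proof (cases "i = 1 \<or> j = 1")
    case True
    then show ?thesis
      using G0[OF that(1)] G0[OF that(2)] C_skew[of "m i" "m 1"] C_self[of "m 1"] by (auto simp: D_def)
  next
    case False
    then have "C (m i) (m j) = 0"
      using cases[OF that(1)] cases[OF that(2)] C0 that Kij by (auto simp: C_def)
    then show ?thesis using False G0[OF that(1)] G0[OF that(2)] by (simp add: D_def)
  qed
  have Dm: "D (m i) v = 0" if "i < N" for i v
  proof -
    have "complexification.span (m ` {..<N}) \<subseteq> {v. D (m i) v = 0}"
      using D that sub2 by (intro complexification.span_minimal) auto
    then show ?thesis using span by auto
  qed
  have "m ` {..<N} \<subseteq> {u. D u y = 0}"
    using Dm by (simp add: image_subset_iff)
  then have "complexification.span (m ` {..<N}) \<subseteq> {u. D u y = 0}"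
    using sub1 by (rule complexification.span_minimal)
  then have "D x y = 0" using span by auto
  then show ?thesis by (simp add: D_def C_def G_def)
qed

lemma complex_type_11:
  assumes f: "lorentz_frame k f" and r: "N = 2 * r + 1" and bv: "bivector K" and K0: "K \<noteq> (\<lambda>x y. 0)"
    and K: "\<And>x y. K x y = (\<Sum>p<r. c p * (\<eta> x (f (2 * p)) * \<eta> y (f (2 * p + 1)) - \<eta> x (f (2 * p + 1)) * \<eta> y (f (2 * p))))"
  shows "complex_alignment_type_11 N \<eta> K"
proof -
  have bil: "bilinear K" and skew: "\<And>x y. K x y = - K y x" using bv unfolding bivector_def by blast+
  note right = normal_form_right[OF f r K]
  note c_right = complexify_form_normal_form_right[OF f r bil K]
  note [simp] = lorentz_frameD[OF f] bilinear_lzero[OF bil] bilinear_rzero[OF bil]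
  have "complexify_form K \<noteq> (\<lambda>x y. 0)"
  proof
    assume "complexify_form K = (\<lambda>x y. 0)"
    then have "complexify_form K (x, 0) (y, 0) = 0" for x y by simp
    then have "K = (\<lambda>x y. 0)"
      by (intro ext) (simp add: complexify_form_def complex_eq_iff)
    then show False using K0 by contradiction
  qed
  moreover have "\<not> alignment_type_2 (complex_null_frame N \<eta>) N (complexify_form K)"
  proof
    assume "alignment_type_2 (complex_null_frame N \<eta>) N (complexify_form K)"
    then obtain m where m: "complex_null_frame N \<eta> m"
      and "\<forall>i\<in>{2..<N}. complexify_form K (m 0) (m i) = 0" "complexify_form K (m 0) (m 1) = 0"
      and "\<forall>i\<in>{2..<N}. \<forall>j\<in>{2..<N}. complexify_form K (m i) (m j) = 0"
      unfolding alignment_type_2_def by blast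
    then have wedge: "complexify_form K x y = complexify_form \<eta> (m 0) x * complexify_form K (m 1) y
        - complexify_form \<eta> (m 0) y * complexify_form K (m 1) x" for x y
      by (intro type_2_wedge[OF bil skew m]) auto
    have "complexify_form \<eta> (m 0) (m 0) = 0"
      using m N_ge by (auto simp: null_frame_def)
    \<comment> \<open>\<open>wedge\<close> at the pair \<open>m 0\<close>, \<open>m 1\<close> reads
      \<open>0 = - K (m 1) (m 0)\<close>; with this, \<open>m 0\<close> lies in the kernel.\<close>
    moreover have "complexify_form K (m 1) (m 0) = 0"
      using wedge[of "m 1" "m 0"] wedge[of "m 0" "m 0"] wedge[of "m 0" "m 1"] \<open>complexify_form K (m 0) (m 1) = 0\<close>
        m N_ge calculation
      by (auto simp: null_frame_def doubleton_eq_iff)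
    ultimately have Kl: "complexify_form K (m 0) y = 0" for y
      using wedge[of "m 0" y] by simp
    have "\<exists>q<r. c q \<noteq> 0"
    proof (rule ccontr)
      assume "\<not> ?thesis"
      then have "K x y = 0" for x y unfolding K by (intro sum.neutral) auto
      then have "K = (\<lambda>x y. 0)" by (intro ext)
      then show False using K0 by contradiction
    qed
    then obtain q where q: "q < r" "c q \<noteq> 0" by blast
    \<comment> \<open>A kernel vector is orthogonal to each plane with
      \<open>c q \<noteq> 0\<close>, so the wedge with \<open>m 0\<close> vanishes on a plane where
      \<open>K\<close> does not.\<close>
    have "complexify_form \<eta> (m 0) (f (2 * q), 0) = 0" "complexify_form \<eta> (m 0) (f (2 * q + 1), 0) = 0"
      using c_right[OF q(1), of "m 0"] Kl q(2) by auto
    then have "complexify_form K (f (2 * q), 0) (f (2 * q + 1), 0) = 0"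
      using wedge[of "(f (2 * q), 0)" "(f (2 * q + 1), 0)"] by simp
    then have "K (f (2 * q)) (f (2 * q + 1)) = 0"
      by (simp add: complexify_form_def complex_eq_iff)
    then show False using right(3)[OF q(1), of "f (2 * q)"] q r by simp
  qed
  moreover have "\<exists>m. complex_null_frame N \<eta> m \<and>
      (\<forall>i\<in>{2..<N}. complexify_form K (m 0) (m i) = 0 \<and> complexify_form K (m 1) (m i) = 0)"
  proof -
    define a where "a = 1 / sqrt 2"
    have aa: "a * a = 1 / 2" by (simp add: a_def)
    \<comment> \<open>The first two vectors are eigenvectors of the complexified \<open>F\<close>,
      so their \<open>K\<close>-products with the later frame vectors vanish. The last one is \<i>
      times \<open>k\<close>, of square \<open>- \<eta> k k = 1\<close>.\<close>
    define m where "m i =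
      (if i = 0 then (a *\<^sub>R f 0, a *\<^sub>R f 1) else if i = 1 then (a *\<^sub>R f 0, (- a) *\<^sub>R f 1)
       else if i = N - 1 then (0, k) else (f i, 0))" for i
    have N: "N - Suc 0 \<noteq> 0" "N - Suc 0 \<noteq> Suc 0" "Suc 0 < N - Suc 0" "0 < N - Suc 0" using N_ge by auto
    have cases: "i = 0 \<or> i = 1 \<or> i = N - 1 \<or> 2 \<le> i \<and> i < N - 1" if "i < N" for i
      using that by auto
    have gram: "complexify_form \<eta> (m i) (m j) =
      (if {i, j} = {0, 1} \<or> (i = j \<and> 2 \<le> i) then 1 else 0)" if "i < N" "j < N" for i j
      using cases[OF that(1)] cases[OF that(2)] N N_ge
      by (elim disjE) (auto simp: m_def complexify_form_def form_simps doubleton_eq_iff complex_eq_iff aa)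
    have Kf: "K (f 0) (f i) = 0" "K (f 1) (f i) = 0" if i: "2 \<le> i" "i < N - 1" for i
    proof -
      \<comment> \<open>\<open>2 \<le> i\<close> puts \<open>f i\<close> in a plane other than that
        of \<open>f 0\<close> and \<open>f 1\<close>.\<close>
      obtain q where q: "i = 2 * q \<or> i = 2 * q + 1" by (metis oddE evenE)
      then have "q < r" "0 < q" using i r by auto
      then show "K (f 0) (f i) = 0" "K (f 1) (f i) = 0"
        using q right(2,3)[of q] r by auto
    qed
    have "complexify_form K (m 0) (m i) = 0 \<and> complexify_form K (m 1) (m i) = 0" if "i \<in> {2..<N}" for i
    proof (cases "i = N - 1")
      case True
      then show ?thesis
        using N by (simp add: m_def complexify_form_def complex_eq_iff bilinear_lmul[OF bil] bilinear_lneg[OF bil] right(1))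
    next
      case False
      then have i: "2 \<le> i" "i < N - 1" using that by auto
      show ?thesis
        using i Kf[OF i] by (simp add: m_def complexify_form_def complex_eq_iff bilinear_lmul[OF bil] bilinear_lneg[OF bil])
    qed
    then show ?thesis using complex_null_frameI[OF gram] by blast
  qed
  ultimately show ?thesis by (simp add: alignment_type_11_def)
qed

end

theorem mainTheorem6:
  fixes \<eta> :: "'v::real_vector \<Rightarrow> 'v \<Rightarrow> real" and N :: nat
  assumes "3 \<le> N" and "odd N"
    and "dim (UNIV :: 'v set) = N"
    and "lorentzian N \<eta>"
  shows "(\<exists>K. bivector K \<and> real_alignment_type_0 N \<eta> K) \<and>
    (\<forall>K. bivector K \<and> real_alignment_type_0 N \<eta> K \<longrightarrow>
       complex_alignment_type_11 N \<eta> K \<and>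
       (\<exists>m c. real_null_frame N \<eta> m \<and>
          (\<forall>x y. K x y =
             c 0 * (lowered_wedge \<eta> (m 1) (m (N - 1)) x y + lowered_wedge \<eta> (m 0) (m (N - 1)) x y)
             + (\<Sum>p = 1..(N - 3) div 2. c p * lowered_wedge \<eta> (m (2 * p)) (m (2 * p + 1)) x y))))"
proof -
  interpret lorentz_space \<eta> N
    using assms(1,4) by unfold_locales (auto simp: lorentzian_def)
  obtain r where r: "N = 2 * r + 1" using assms(2) by (rule oddE)
  show ?thesis
  proof (intro conjI allI impI)
    show "\<exists>K. bivector K \<and> real_alignment_type_0 N \<eta> K" by (rule type_0_exists[OF r])
  next
    fix K assume K: "bivector K \<and> real_alignment_type_0 N \<eta> K"
    then have bv: "bivector K" and type_0: "real_alignment_type_0 N \<eta> K" by blast+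
    obtain k where k: "\<eta> k k = -1" "\<And>y. K k y = 0"
      using timelike_kernel[OF bv type_0_no_null_eigenvector[OF type_0]] by blast
    obtain f c where f: "lorentz_frame k f" and
      normal: "\<And>x y. K x y = (\<Sum>p<r. c p * (\<eta> x (f (2 * p)) * \<eta> y (f (2 * p + 1)) - \<eta> x (f (2 * p + 1)) * \<eta> y (f (2 * p))))"
      by (rule bivector_normal_form[OF bv k r]) blast
    have "K \<noteq> (\<lambda>x y. 0)" using type_0 by (simp add: alignment_type_0_def)
    then show "complex_alignment_type_11 N \<eta> K" by (rule complex_type_11[OF f r bv _ normal])
    show "\<exists>m c. real_null_frame N \<eta> m \<and>
        (\<forall>x y. K x y =
           c 0 * (lowered_wedge \<eta> (m 1) (m (N - 1)) x y + lowered_wedge \<eta> (m 0) (m (N - 1)) x y)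
           + (\<Sum>p = 1..(N - 3) div 2. c p * lowered_wedge \<eta> (m (2 * p)) (m (2 * p + 1)) x y))"
      by (rule canonical_form[OF f r normal])
  qed
qed

end
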